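(* Let $C\subseteq\mathrm{Int}(n)$ be an equivalence class under the relation $\overset{D}{\simeq}$. Then $\overline{\min}(C)=\{\sigma\mid[\sigma,\rho]_L\in C\}$ and $\overline{\max}(C)=\{\rho\mid[\sigma,\rho]_L\in C\}$ are right weak Bruhat intervals in $(\mathfrak S_n,\preceq_R)$.
   Context: $\mathfrak S_n$ is the symmetric group on $[n]=\{1,\dots,n\}$ with length function $\ell$ and simple transpositions $s_i=(i,i+1)$. For $\sigma\in\mathfrak S_n$, $\mathrm{Des}_L(\sigma)=\{i\in[n-1]\mid\ell(s_i\sigma)<\ell(\sigma)\}$. The left (resp. right) weak Bruhat order $\preceq_L$ (resp. $\preceq_R$) is the partial order on $\mathfrak S_n$ with covering relations $\sigma\prec s_i\sigma$ whenever $\ell(s_i\sigma)>\ell(\sigma)$ (resp. $\sigma\prec\sigma s_i$ whenever $\ell(\sigma s_i)>\ell(\sigma)$). $[\sigma,\rho]_L=\{\gamma\mid\sigma\preceq_L\gamma\preceq_L\rho\}$ and $[\sigma,\rho]_R=\{\gamma\mid\sigma\preceq_R\gamma\preceq_R\rho\}$; the latter are called right weak Bruhat intervals. $\mathrm{Int}(n)=\{[\sigma,\rho]_L\mid\sigma,\rho\in\mathfrak S_n,\ \sigma\preceq_L\rho\}$ is the set of nonempty left weak Bruhat intervals. For $I_1,I_2\in\mathrm{Int}(n)$, a poset isomorphism $f:(I_1,\preceq_L)\to(I_2,\preceq_L)$ is descent-preserving if $\mathrm{Des}_L(\gamma)=\mathrm{Des}_L(f(\gamma))$ for all $\gamma\in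 I_1$. The equivalence relation $\overset{D}{\simeq}$ on $\mathrm{Int}(n)$ is: $I_1\overset{D}{\simeq}I_2$ if there is a descent-preserving poset isomorphism between $(I_1,\preceq_L)$ and $(I_2,\preceq_L)$. *)

theory Defs
  imports "HOL-Combinatorics.Permutations"
begin

text \<open>Permutations are functions on \<^typ>\<open>nat\<close> fixing everything outside \<open>{1..n}\<close>, and products are
  compositions of functions, so left multiplication acts on values and right multiplication on positions.\<close>

definition Sym :: "nat \<Rightarrow> (nat \<Rightarrow> nat) set" where
  "Sym n = {\<sigma>. \<sigma> permutes {1..n}}"

definition simple_transp :: "nat \<Rightarrow> nat \<Rightarrow> nat" where
  "simple_transp i = transpose i (i + 1)"

definition word_prod :: "nat list \<Rightarrow> nat \<Rightarrow> nat" where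
  "word_prod w = foldr (\<lambda>i \<tau>. simple_transp i \<circ> \<tau>) w id"

text \<open>The Coxeter length, i.e. the length of a reduced word in the simple transpositions.\<close>

definition perm_len :: "nat \<Rightarrow> (nat \<Rightarrow> nat) \<Rightarrow> nat" where
  "perm_len n \<sigma> = (LEAST k. \<exists>w. length w = k \<and> set w \<subseteq> {1..<n} \<and> \<sigma> = word_prod w)"

definition Des_L :: "nat \<Rightarrow> (nat \<Rightarrow> nat) \<Rightarrow> nat set" where
  "Des_L n \<sigma> = {i \<in> {1..<n}. perm_len n (simple_transp i \<circ> \<sigma>) < perm_len n \<sigma>}"

definition cover_L :: "nat \<Rightarrow> (nat \<Rightarrow> nat) \<Rightarrow> (nat \<Rightarrow> nat) \<Rightarrow> bool" where
  "cover_L n \<sigma> \<tau> \<longleftrightarrow>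
     (\<exists>i\<in>{1..<n}. \<tau> = simple_transp i \<circ> \<sigma> \<and> perm_len n (simple_transp i \<circ> \<sigma>) > perm_len n \<sigma>)"

definition cover_R :: "nat \<Rightarrow> (nat \<Rightarrow> nat) \<Rightarrow> (nat \<Rightarrow> nat) \<Rightarrow> bool" where
  "cover_R n \<sigma> \<tau> \<longleftrightarrow>
     (\<exists>i\<in>{1..<n}. \<tau> = \<sigma> \<circ> simple_transp i \<and> perm_len n (\<sigma> \<circ> simple_transp i) > perm_len n \<sigma>)"

definition weak_L :: "nat \<Rightarrow> (nat \<Rightarrow> nat) \<Rightarrow> (nat \<Rightarrow> nat) \<Rightarrow> bool" where
  "weak_L n \<sigma> \<rho> \<longleftrightarrow> \<sigma> \<in> Sym n \<and> \<rho> \<in> Sym n \<and> (cover_L n)\<^sup>*\<^sup>* \<sigma> \<rho>"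

definition weak_R :: "nat \<Rightarrow> (nat \<Rightarrow> nat) \<Rightarrow> (nat \<Rightarrow> nat) \<Rightarrow> bool" where
  "weak_R n \<sigma> \<rho> \<longleftrightarrow> \<sigma> \<in> Sym n \<and> \<rho> \<in> Sym n \<and> (cover_R n)\<^sup>*\<^sup>* \<sigma> \<rho>"

definition interval_L :: "nat \<Rightarrow> (nat \<Rightarrow> nat) \<Rightarrow> (nat \<Rightarrow> nat) \<Rightarrow> (nat \<Rightarrow> nat) set" where
  "interval_L n \<sigma> \<rho> = {\<gamma>. weak_L n \<sigma> \<gamma> \<and> weak_L n \<gamma> \<rho>}"

definition interval_R :: "nat \<Rightarrow> (nat \<Rightarrow> nat) \<Rightarrow> (nat \<Rightarrow> nat) \<Rightarrow> (nat \<Rightarrow> nat) set" where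
  "interval_R n \<sigma> \<rho> = {\<gamma>. weak_R n \<sigma> \<gamma> \<and> weak_R n \<gamma> \<rho>}"

definition Int_L :: "nat \<Rightarrow> (nat \<Rightarrow> nat) set set" where
  "Int_L n = {interval_L n \<sigma> \<rho> | \<sigma> \<rho>. \<sigma> \<in> Sym n \<and> \<rho> \<in> Sym n \<and> weak_L n \<sigma> \<rho>}"

definition Int_R :: "nat \<Rightarrow> (nat \<Rightarrow> nat) set set" where
  "Int_R n = {interval_R n \<sigma> \<rho> | \<sigma> \<rho>. \<sigma> \<in> Sym n \<and> \<rho> \<in> Sym n \<and> weak_R n \<sigma> \<rho>}"

definition poset_iso_L ::
    "nat \<Rightarrow> (nat \<Rightarrow> nat) set \<Rightarrow> (nat \<Rightarrow> nat) set \<Rightarrow> ((nat \<Rightarrow> nat) \<Rightarrow> nat \<Rightarrow> nat) \<Rightarrow> bool" where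
  "poset_iso_L n I1 I2 f \<longleftrightarrow>
     bij_betw f I1 I2 \<and> (\<forall>\<gamma>\<in>I1. \<forall>\<delta>\<in>I1. weak_L n \<gamma> \<delta> \<longleftrightarrow> weak_L n (f \<gamma>) (f \<delta>))"

definition descent_preserving ::
    "nat \<Rightarrow> (nat \<Rightarrow> nat) set \<Rightarrow> ((nat \<Rightarrow> nat) \<Rightarrow> nat \<Rightarrow> nat) \<Rightarrow> bool" where
  "descent_preserving n I f \<longleftrightarrow> (\<forall>\<gamma>\<in>I. Des_L n \<gamma> = Des_L n (f \<gamma>))"

definition D_equiv :: "nat \<Rightarrow> ((nat \<Rightarrow> nat) set \<times> (nat \<Rightarrow> nat) set) set" where
  "D_equiv n = {(I1, I2). I1 \<in> Int_L n \<and> I2 \<in> Int_L n \<and>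
     (\<exists>f. poset_iso_L n I1 I2 f \<and> descent_preserving n I1 f)}"

lemma equiv_D_equiv: "equiv (Int_L n) (D_equiv n)"
proof (rule equivI)
  show "D_equiv n \<subseteq> Int_L n \<times> Int_L n"
    by (auto simp: D_equiv_def)
  show "refl_on (Int_L n) (D_equiv n)"
  proof (rule refl_onI)
    fix I assume "I \<in> Int_L n"
    moreover have "poset_iso_L n I I id" "descent_preserving n I id"
      by (auto simp: poset_iso_L_def descent_preserving_def)
    ultimately show "(I, I) \<in> D_equiv n"
      unfolding D_equiv_def by blast
  qed
  show "sym (D_equiv n)"
  proof (rule symI)
    fix I J assume "(I, J) \<in> D_equiv n"
    then obtain f where IJ: "I \<in> Int_L n" "J \<in> Int_L n"
      and f: "poset_iso_L n I J f" "descent_preserving n I f"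
      unfolding D_equiv_def by blast
    let ?g = "inv_into I f"
    have bij: "bij_betw f I J" using f by (simp add: poset_iso_L_def)
    have g: "?g y \<in> I" "f (?g y) = y" if "y \<in> J" for y
      using bij that by (auto simp: bij_betw_def inv_into_into f_inv_into_f)
    have "poset_iso_L n J I ?g" "descent_preserving n J ?g"
      using f g bij_betw_inv_into[OF bij]
      by (auto simp: poset_iso_L_def descent_preserving_def)
    with IJ show "(J, I) \<in> D_equiv n"
      unfolding D_equiv_def by blast
  qed
  show "trans (D_equiv n)"
  proof (rule transI)
    fix I J K assume "(I, J) \<in> D_equiv n" "(J, K) \<in> D_equiv n"
    then obtain f g where IK: "I \<in> Int_L n" "K \<in> Int_L n"
      and f: "poset_iso_L n I J f" "descent_preserving n I f"
      and g: "poset_iso_L n J K g" "descent_preserving n J g"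
      unfolding D_equiv_def by blast
    have fJ: "f x \<in> J" if "x \<in> I" for x
      using f that by (auto simp: poset_iso_L_def bij_betw_def)
    have "poset_iso_L n I K (g \<circ> f)" "descent_preserving n I (g \<circ> f)"
      using f g fJ by (auto simp: poset_iso_L_def descent_preserving_def intro: bij_betw_trans)
    with IK show "(I, K) \<in> D_equiv n"
      unfolding D_equiv_def by blast
  qed
qed

definition min_set :: "nat \<Rightarrow> (nat \<Rightarrow> nat) set set \<Rightarrow> (nat \<Rightarrow> nat) set" where
  "min_set n C = {\<sigma>. \<exists>\<rho>. \<sigma> \<in> Sym n \<and> \<rho> \<in> Sym n \<and> interval_L n \<sigma> \<rho> \<in> C}"

definition max_set :: "nat \<Rightarrow> (nat \<Rightarrow> nat) set set \<Rightarrow> (nat \<Rightarrow> nat) set" where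
  "max_set n C = {\<rho>. \<exists>\<sigma>. \<sigma> \<in> Sym n \<and> \<rho> \<in> Sym n \<and> interval_L n \<sigma> \<rho> \<in> C}"

end

theory Submission
  imports Defs
begin

text \<open>Both weak orders are inclusion orders of inversion sets: pairs of positions for the left order, pairs
  of values for the right one (\<open>weak_L_iff_inversions\<close>, \<open>weak_R_iff_inversions\<close>). Fix one interval
  \<open>[\<sigma>\<^sub>0, \<rho>\<^sub>0]\<^sub>L\<close> of the class and put \<open>\<xi> = \<rho>\<^sub>0 \<sigma>\<^sub>0\<inverse>\<close>. The interval is the set of all \<open>u \<sigma>\<^sub>0\<close> with \<open>u \<preceq>\<^sub>L \<xi>\<close>.

  If \<open>\<delta> \<prec> s\<^sub>j \<delta>\<close> is a cover, then \<open>j\<close> is the only descent of \<open>s\<^sub>j \<delta>\<close> that is not one of \<open>\<delta>\<close>. A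
  descent-preserving isomorphism therefore preserves the labels of covers and has to be the right
  translation \<open>u \<sigma>\<^sub>0 \<mapsto> u \<sigma>\<close>. Now \<open>i\<close> is a descent of \<open>u \<sigma>\<close> if and only if \<open>u\<inverse> (i + 1)\<close> occurs before
  \<open>u\<inverse> i\<close> in the word of \<open>\<sigma>\<close>. So an interval \<open>[\<sigma>, \<rho>]\<^sub>L\<close> belongs to the class if and only if \<open>\<rho> = \<xi> \<sigma>\<close> and
  \<open>\<sigma>\<close> orders all pairs of values that some \<open>u \<preceq>\<^sub>L \<xi>\<close> makes adjacent in the same way as \<open>\<sigma>\<^sub>0\<close>
  (\<open>D_equiv_if_lin_ext\<close>, \<open>lin_ext_if_D_equiv\<close>). In other words, the minima of the class are the linear
  extensions of a relation \<open>R\<close> on the values, and the maxima are the linear extensions of its image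
  under \<open>\<xi>\<close>.

  By a theorem of Bjorner and Wachs (\<open>lin_ext_in_Int_R\<close>), linear extensions, if there
  are any, form a right weak order interval as soon as, for each related pair of labels, every label strictly between them is related to one of
  them. For \<open>R\<close> and for its image this holds (\<open>regular_adjacency_rel\<close>): if \<open>u\<close> makes \<open>x\<close> and \<open>y\<close>
  adjacent and \<open>b\<close> separates them, before or after applying \<open>\<xi>\<close>, then \<open>b\<close> has changed sides with \<open>x\<close>
  or with \<open>y\<close>, so \<open>\<xi>\<close> inverts that pair; and on a chain from \<open>id\<close> to \<open>\<xi>\<close> every inverted pair becomes
  adjacent at some point, hence belongs to \<open>R\<close> in one of the two orders.\<close>

section \<open>Permutations and their inversions\<close>

definition inversions :: "(nat \<Rightarrow> nat) \<Rightarrow> (nat \<times> nat) set" where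
  "inversions \<sigma> = {(i, j). i < j \<and> \<sigma> j < \<sigma> i}"

lemma simple_transp_in_Sym: "i \<in> {1..<n} \<Longrightarrow> simple_transp i \<in> Sym n"
  by (auto simp: Sym_def simple_transp_def intro: permutes_swap_id)

lemma Sym_comp: "\<sigma> \<in> Sym n \<Longrightarrow> \<tau> \<in> Sym n \<Longrightarrow> \<sigma> \<circ> \<tau> \<in> Sym n"
  by (simp add: Sym_def permutes_compose)

lemma Sym_inv: "\<sigma> \<in> Sym n \<Longrightarrow> inv \<sigma> \<in> Sym n"
  by (simp add: Sym_def permutes_inv)

lemma Sym_id: "id \<in> Sym n"
  by (simp add: Sym_def permutes_id)

lemma Sym_inv_comp [simp]: "\<sigma> \<in> Sym n \<Longrightarrow> inv \<sigma> \<circ> \<sigma> = id"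
  by (simp add: Sym_def permutes_inv_o)

lemma Sym_comp_inv [simp]: "\<sigma> \<in> Sym n \<Longrightarrow> \<sigma> \<circ> inv \<sigma> = id"
  by (simp add: Sym_def permutes_inv_o)

lemma Sym_inv_apply [simp]: "\<sigma> \<in> Sym n \<Longrightarrow> inv \<sigma> (\<sigma> x) = x"
  by (simp add: Sym_def permutes_inverses)

lemma Sym_apply_inv [simp]: "\<sigma> \<in> Sym n \<Longrightarrow> \<sigma> (inv \<sigma> x) = x"
  by (simp add: Sym_def permutes_inverses)

lemma Sym_inv_inv: "\<sigma> \<in> Sym n \<Longrightarrow> inv (inv \<sigma>) = \<sigma>"
  by (simp add: Sym_def permutes_inv_inv)

lemma Sym_inv_of_comp: "\<sigma> \<in> Sym n \<Longrightarrow> \<tau> \<in> Sym n \<Longrightarrow> inv (\<sigma> \<circ> \<tau>) = inv \<tau> \<circ> inv \<sigma>"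
  by (simp add: Sym_def o_inv_distrib permutes_bij)

lemma Sym_eq_iff: "\<sigma> \<in> Sym n \<Longrightarrow> \<sigma> x = \<sigma> y \<longleftrightarrow> x = y"
  by (simp add: Sym_def inj_eq permutes_inj)

lemma Sym_range_iff: "\<sigma> \<in> Sym n \<Longrightarrow> \<sigma> x \<in> {1..n} \<longleftrightarrow> x \<in> {1..n}"
  by (rule permutes_in_image) (simp add: Sym_def)

lemma simple_transp_simps [simp]:
  "simple_transp i i = Suc i" "simple_transp i (Suc i) = i"
  "x \<noteq> i \<Longrightarrow> x \<noteq> Suc i \<Longrightarrow> simple_transp i x = x"
  by (auto simp: simple_transp_def)

lemma simple_transp_involution [simp]: "simple_transp i (simple_transp i x) = x"
  by (simp add: simple_transp_def)

lemma inv_simple_transp [simp]: "inv (simple_transp i) = simple_transp i"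
  by (simp add: simple_transp_def)

lemma simple_transp_comp_cancel [simp]: "simple_transp i \<circ> (simple_transp i \<circ> \<sigma>) = \<sigma>"
  by (rule ext) simp

lemma inversions_subset: "\<sigma> \<in> Sym n \<Longrightarrow> inversions \<sigma> \<subseteq> {1..n} \<times> {1..n}"
proof
  fix p assume s: "\<sigma> \<in> Sym n" and "p \<in> inversions \<sigma>"
  obtain i j where p: "p = (i, j)" by fastforce
  with \<open>p \<in> inversions \<sigma>\<close> have ij: "i < j" "\<sigma> j < \<sigma> i" by (auto simp: inversions_def)
  have fix_out: "\<sigma> x = x" if "x \<notin> {1..n}" for x
    using s that by (auto simp: Sym_def permutes_def)
  have i: "i \<in> {1..n}"
  proof (rule ccontr)
    assume "i \<notin> {1..n}"
    then have "i = 0 \<or> n < i \<and> n < j" using ij by auto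
    then show False using fix_out[of i] fix_out[of j] ij by auto
  qed
  moreover have "j \<in> {1..n}"
  proof (rule ccontr)
    assume "j \<notin> {1..n}"
    then have "n < j" "\<sigma> j = j" using fix_out[of j] ij i by auto
    moreover have "\<sigma> i \<le> n" using Sym_range_iff[OF s, of i] i by simp
    ultimately show False using ij by simp
  qed
  ultimately show "p \<in> {1..n} \<times> {1..n}" by (simp add: p)
qed

lemma inversions_id: "inversions id = {}"
  by (auto simp: inversions_def)

lemma finite_inversions: "\<sigma> \<in> Sym n \<Longrightarrow> finite (inversions \<sigma>)"
  by (rule finite_subset[OF inversions_subset[of \<sigma> n]]) simp_all

text \<open>Multiplying on the left by \<open>s\<^sub>i\<close> exchanges the adjacent values \<open>i\<close> and \<open>i + 1\<close>. Every other value
  lies on the same side of both, so only the pair of positions holding them changes its order.\<close>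

lemma inversions_simple_transp:
  assumes s: "\<sigma> \<in> Sym n" and up: "inv \<sigma> i < inv \<sigma> (Suc i)"
  shows "inversions (simple_transp i \<circ> \<sigma>) = insert (inv \<sigma> i, inv \<sigma> (Suc i)) (inversions \<sigma>)"
    and "(inv \<sigma> i, inv \<sigma> (Suc i)) \<notin> inversions \<sigma>"
proof -
  have eq: "\<sigma> x = y \<longleftrightarrow> x = inv \<sigma> y" for x y
    using permutes_inv_eq[of \<sigma> "{1..n}" y x] s by (auto simp: Sym_def)
  have "(a, b) \<in> inversions (simple_transp i \<circ> \<sigma>) \<longleftrightarrow>
        (a, b) = (inv \<sigma> i, inv \<sigma> (Suc i)) \<or> (a, b) \<in> inversions \<sigma>" for a b
  proof (cases "\<sigma> a \<in> {i, Suc i} \<and> \<sigma> b \<in> {i, Suc i}")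
    case True
    then have "a = inv \<sigma> i \<or> a = inv \<sigma> (Suc i)" "b = inv \<sigma> i \<or> b = inv \<sigma> (Suc i)"
      by (simp_all add: eq)
    moreover have "\<sigma> (inv \<sigma> i) = i" "\<sigma> (inv \<sigma> (Suc i)) = Suc i" using s by simp_all
    ultimately show ?thesis using up by (elim disjE) (simp_all add: inversions_def)
  next
    case False
    then have "(a, b) \<noteq> (inv \<sigma> i, inv \<sigma> (Suc i))"
      using Sym_apply_inv[OF s] by force
    moreover have "simple_transp i (\<sigma> b) < simple_transp i (\<sigma> a) \<longleftrightarrow> \<sigma> b < \<sigma> a"
      using False by (auto simp: simple_transp_def transpose_def)
    ultimately show ?thesis by (auto simp: inversions_def)
  qed
  then show "inversions (simple_transp i \<circ> \<sigma>) = insert (inv \<sigma> i, inv \<sigma> (Suc i)) (inversions \<sigma>)"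
    by auto
  show "(inv \<sigma> i, inv \<sigma> (Suc i)) \<notin> inversions \<sigma>"
    using s by (simp add: inversions_def)
qed

text \<open>An increasing permutation satisfies \<open>i \<le> \<sigma> i\<close> for all \<open>i\<close>, by climbing from \<open>1\<close>; a permutation that
  never decreases a number is the identity.\<close>

lemma Sym_eq_id_if_increasing:
  assumes s: "\<sigma> \<in> Sym n" and inc: "\<And>i. i \<in> {1..<n} \<Longrightarrow> \<sigma> i < \<sigma> (Suc i)"
  shows "\<sigma> = id"
proof -
  have ge: "i \<le> n \<Longrightarrow> i \<le> \<sigma> i" for i
  proof (induction i)
    case (Suc i)
    show ?case
    proof (cases "i = 0")
      case True
      then show ?thesis using Suc Sym_range_iff[OF s, of 1] by simp
    next
      case False
      then have "\<sigma> i < \<sigma> (Suc i)" using Suc by (intro inc) simp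
      then show ?thesis using Suc by simp
    qed
  qed simp
  show ?thesis
    using s by (intro permutes_natset_ge[of \<sigma> "{1..n}"]) (auto simp: Sym_def ge)
qed

section \<open>The weak orders as inclusion of inversions\<close>

text \<open>The covers of the left weak order, described by positions instead of by length. The length of a
  permutation can then be computed by counting steps of this relation.\<close>

definition up_L :: "nat \<Rightarrow> (nat \<Rightarrow> nat) \<Rightarrow> (nat \<Rightarrow> nat) \<Rightarrow> bool" where
  "up_L n \<sigma> \<tau> \<longleftrightarrow> (\<exists>i\<in>{1..<n}. \<tau> = simple_transp i \<circ> \<sigma> \<and> inv \<sigma> i < inv \<sigma> (Suc i))"

lemma up_L_Sym: "up_L n \<sigma> \<tau> \<Longrightarrow> \<sigma> \<in> Sym n \<Longrightarrow> \<tau> \<in> Sym n"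
  unfolding up_L_def using Sym_comp simple_transp_in_Sym by blast

lemma up_L_card_inversions:
  "up_L n \<sigma> \<tau> \<Longrightarrow> \<sigma> \<in> Sym n \<Longrightarrow> card (inversions \<tau>) = Suc (card (inversions \<sigma>))"
  by (auto simp: up_L_def inversions_simple_transp finite_inversions)

text \<open>As long as \<open>\<sigma> \<noteq> \<rho>\<close>, the permutation \<open>\<rho> \<sigma>\<inverse>\<close> is not the identity and has a descent at some \<open>i\<close>.
  The values \<open>i\<close> and \<open>i + 1\<close> of \<open>\<sigma>\<close> then sit at positions that \<open>\<rho>\<close> inverts and \<open>\<sigma>\<close> does not, so passing
  to \<open>s\<^sub>i \<sigma>\<close> adds one inversion and stays below \<open>\<rho>\<close>.\<close>

lemma inversions_subset_imp_up_chain: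
  assumes "\<sigma> \<in> Sym n" "\<rho> \<in> Sym n" "inversions \<sigma> \<subseteq> inversions \<rho>"
  shows "(up_L n)\<^sup>*\<^sup>* \<sigma> \<rho>"
  using assms
proof (induction "card (inversions \<rho> - inversions \<sigma>)" arbitrary: \<sigma> rule: less_induct)
  case less
  note s = less.prems(1) and r = less.prems(2) and sub = less.prems(3)
  show ?case
  proof (cases "\<rho> = \<sigma>")
    case False
    have "\<rho> \<circ> inv \<sigma> \<noteq> id"
    proof
      assume "\<rho> \<circ> inv \<sigma> = id"
      then have "\<rho> (inv \<sigma> (\<sigma> x)) = \<sigma> x" for x by (metis comp_apply id_apply)
      with s False show False by auto
    qed
    with Sym_eq_id_if_increasing[OF Sym_comp[OF r Sym_inv[OF s]]]
    obtain i where i: "i \<in> {1..<n}" and "\<not> \<rho> (inv \<sigma> i) < \<rho> (inv \<sigma> (Suc i))"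
      by auto
    moreover have "\<rho> (inv \<sigma> i) \<noteq> \<rho> (inv \<sigma> (Suc i))"
      using Sym_eq_iff[OF r] Sym_eq_iff[OF Sym_inv[OF s]] by simp
    ultimately have down: "\<rho> (inv \<sigma> (Suc i)) < \<rho> (inv \<sigma> i)" by simp
    have up: "inv \<sigma> i < inv \<sigma> (Suc i)"
    proof (rule ccontr)
      assume "\<not> inv \<sigma> i < inv \<sigma> (Suc i)"
      then have "(inv \<sigma> (Suc i), inv \<sigma> i) \<in> inversions \<sigma>"
        using s Sym_eq_iff[OF Sym_inv[OF s], of i "Suc i"] by (simp add: inversions_def)
      with sub have "(inv \<sigma> (Suc i), inv \<sigma> i) \<in> inversions \<rho>" by blast
      with down show False by (simp add: inversions_def)
    qed
    let ?t = "simple_transp i \<circ> \<sigma>"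
    have step: "up_L n \<sigma> ?t" using i up by (auto simp: up_L_def)
    have new: "(inv \<sigma> i, inv \<sigma> (Suc i)) \<in> inversions \<rho>"
      using up down by (simp add: inversions_def)
    have "card (inversions \<rho> - inversions ?t) < card (inversions \<rho> - inversions \<sigma>)"
      using new inversions_simple_transp[OF s up] finite_inversions[OF r]
      by (intro psubset_card_mono) auto
    moreover have "inversions ?t \<subseteq> inversions \<rho>"
      using new sub inversions_simple_transp[OF s up] by auto
    ultimately have "(up_L n)\<^sup>*\<^sup>* ?t \<rho>"
      using up_L_Sym[OF step s] r by (intro less.hyps)
    with step show ?thesis by (rule converse_rtranclp_into_rtranclp)
  qed simp
qed

lemma word_prod_Cons: "word_prod (i # w) = simple_transp i \<circ> word_prod w"
  and word_prod_Nil: "word_prod [] = id"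
  by (simp_all add: word_prod_def)

lemma word_prod_in_Sym: "set w \<subseteq> {1..<n} \<Longrightarrow> word_prod w \<in> Sym n"
proof (induction w)
  case (Cons i w)
  then have "simple_transp i \<in> Sym n" "word_prod w \<in> Sym n"
    by (simp_all add: simple_transp_in_Sym)
  then show ?case unfolding word_prod_Cons by (rule Sym_comp)
qed (simp only: word_prod_Nil Sym_id)

lemma simple_transp_up_or_down:
  assumes s: "\<sigma> \<in> Sym n" and i: "i \<in> {1..<n}"
  shows "up_L n \<sigma> (simple_transp i \<circ> \<sigma>) \<and> inv \<sigma> i < inv \<sigma> (Suc i) \<or>
    up_L n (simple_transp i \<circ> \<sigma>) \<sigma> \<and> inv \<sigma> (Suc i) < inv \<sigma> i"
proof (cases "inv \<sigma> i < inv \<sigma> (Suc i)")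
  case True
  then show ?thesis using i by (auto simp: up_L_def)
next
  case False
  moreover have "inv \<sigma> i \<noteq> inv \<sigma> (Suc i)"
    using Sym_eq_iff[OF Sym_inv[OF s]] by simp
  ultimately have lt: "inv \<sigma> (Suc i) < inv \<sigma> i" by simp
  moreover have "inv (simple_transp i \<circ> \<sigma>) = inv \<sigma> \<circ> simple_transp i"
    using Sym_inv_of_comp[OF simple_transp_in_Sym[OF i] s] by simp
  ultimately have "up_L n (simple_transp i \<circ> \<sigma>) \<sigma>"
    unfolding up_L_def using i by (intro bexI[of _ i]) auto
  with lt show ?thesis by blast
qed

lemma card_inversions_word_prod: "set w \<subseteq> {1..<n} \<Longrightarrow> card (inversions (word_prod w)) \<le> length w"
proof (induction w)
  case (Cons i w)
  then have w: "word_prod w \<in> Sym n" and i: "i \<in> {1..<n}"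
    using word_prod_in_Sym[of w n] by auto
  then have "simple_transp i \<circ> word_prod w \<in> Sym n"
    by (intro Sym_comp simple_transp_in_Sym)
  with simple_transp_up_or_down[OF w i] up_L_card_inversions w
  have "card (inversions (simple_transp i \<circ> word_prod w)) \<le> Suc (card (inversions (word_prod w)))"
    by (metis Suc_n_not_le_n nat_le_linear le_SucI)
  moreover have "card (inversions (word_prod w)) \<le> length w" using Cons by simp
  ultimately show ?case unfolding word_prod_Cons length_Cons by linarith
qed (simp add: word_prod_Nil inversions_id[unfolded id_def] id_def)

lemma up_chain_word:
  assumes "(up_L n)\<^sup>*\<^sup>* id \<sigma>"
  shows "\<sigma> \<in> Sym n \<and> (\<exists>w. length w = card (inversions \<sigma>) \<and> set w \<subseteq> {1..<n} \<and> \<sigma> = word_prod w)"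
  using assms
proof (induction rule: rtranclp_induct)
  case base
  have "length ([] :: nat list) = card (inversions id) \<and> set ([] :: nat list) \<subseteq> {1..<n} \<and>
      id = word_prod []"
    by (simp add: word_prod_Nil inversions_id)
  with Sym_id show ?case by blast
next
  case (step \<sigma> \<tau>)
  then obtain w where s: "\<sigma> \<in> Sym n" and
    w: "length w = card (inversions \<sigma>)" "set w \<subseteq> {1..<n}" "\<sigma> = word_prod w" by blast
  from step obtain i where "i \<in> {1..<n}" "\<tau> = simple_transp i \<circ> \<sigma>" by (auto simp: up_L_def)
  with w up_L_card_inversions[OF step(2) s]
  have "length (i # w) = card (inversions \<tau>) \<and> set (i # w) \<subseteq> {1..<n} \<and> \<tau> = word_prod (i # w)"
    by (auto simp: word_prod_Cons)
  with up_L_Sym[OF step(2) s] show ?case by blast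
qed

text \<open>Each letter of a word changes the number of inversions by exactly one, so a word for \<open>\<sigma>\<close> has at
  least as many letters as \<open>\<sigma>\<close> has inversions; the chain of covers from \<open>id\<close> to \<open>\<sigma>\<close> spells a word
  that attains this bound.\<close>

theorem perm_len_eq_card_inversions:
  assumes s: "\<sigma> \<in> Sym n"
  shows "perm_len n \<sigma> = card (inversions \<sigma>)"
  unfolding perm_len_def
proof (rule Least_equality)
  have "inversions id \<subseteq> inversions \<sigma>" by (simp add: inversions_id)
  with up_chain_word inversions_subset_imp_up_chain[OF Sym_id s]
  show "\<exists>w. length w = card (inversions \<sigma>) \<and> set w \<subseteq> {1..<n} \<and> \<sigma> = word_prod w" by blast
qed (auto simp: card_inversions_word_prod)

lemma perm_len_simple_transp_less_iff:
  assumes s: "\<sigma> \<in> Sym n" and i: "i \<in> {1..<n}"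
  shows "perm_len n (simple_transp i \<circ> \<sigma>) < perm_len n \<sigma> \<longleftrightarrow> inv \<sigma> (Suc i) < inv \<sigma> i"
    and "perm_len n \<sigma> < perm_len n (simple_transp i \<circ> \<sigma>) \<longleftrightarrow> inv \<sigma> i < inv \<sigma> (Suc i)"
proof -
  have t: "simple_transp i \<circ> \<sigma> \<in> Sym n" using s i by (intro Sym_comp simple_transp_in_Sym)
  note len = perm_len_eq_card_inversions[OF s] perm_len_eq_card_inversions[OF t]
  show "perm_len n (simple_transp i \<circ> \<sigma>) < perm_len n \<sigma> \<longleftrightarrow> inv \<sigma> (Suc i) < inv \<sigma> i"
    using simple_transp_up_or_down[OF s i] up_L_card_inversions s t unfolding len
    by (metis lessI less_asym)
  show "perm_len n \<sigma> < perm_len n (simple_transp i \<circ> \<sigma>) \<longleftrightarrow> inv \<sigma> i < inv \<sigma> (Suc i)"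
    using simple_transp_up_or_down[OF s i] up_L_card_inversions s t unfolding len
    by (metis lessI less_asym)
qed

lemma Des_L_iff: "\<sigma> \<in> Sym n \<Longrightarrow> i \<in> Des_L n \<sigma> \<longleftrightarrow> i \<in> {1..<n} \<and> inv \<sigma> (Suc i) < inv \<sigma> i"
  unfolding Des_L_def using perm_len_simple_transp_less_iff by blast

lemma cover_L_iff_up_L: "\<sigma> \<in> Sym n \<Longrightarrow> cover_L n \<sigma> \<tau> \<longleftrightarrow> up_L n \<sigma> \<tau>"
  unfolding cover_L_def up_L_def using perm_len_simple_transp_less_iff by blast

lemma weak_L_iff_up_chain:
  "weak_L n \<sigma> \<rho> \<longleftrightarrow> \<sigma> \<in> Sym n \<and> \<rho> \<in> Sym n \<and> (up_L n)\<^sup>*\<^sup>* \<sigma> \<rho>"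
proof -
  have "(cover_L n)\<^sup>*\<^sup>* \<sigma> \<rho> \<Longrightarrow> (up_L n)\<^sup>*\<^sup>* \<sigma> \<rho> \<and> \<rho> \<in> Sym n" if "\<sigma> \<in> Sym n"
    by (induction rule: rtranclp_induct)
      (auto simp: that cover_L_iff_up_L intro: rtranclp.rtrancl_into_rtrancl up_L_Sym)
  moreover have "(up_L n)\<^sup>*\<^sup>* \<sigma> \<rho> \<Longrightarrow> (cover_L n)\<^sup>*\<^sup>* \<sigma> \<rho> \<and> \<rho> \<in> Sym n" if "\<sigma> \<in> Sym n"
    by (induction rule: rtranclp_induct)
      (auto simp: that cover_L_iff_up_L[symmetric] intro: rtranclp.rtrancl_into_rtrancl,
       simp add: cover_L_iff_up_L up_L_Sym)
  ultimately show ?thesis unfolding weak_L_def by blast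
qed

text \<open>Together with its counterpart \<open>weak_R_iff_inversions\<close> for the right weak order, where inversions
  are pairs of values rather than of positions, this turns every later question about the weak
  orders into one about comparisons of numbers.\<close>

theorem weak_L_iff_inversions:
  "weak_L n \<sigma> \<rho> \<longleftrightarrow> \<sigma> \<in> Sym n \<and> \<rho> \<in> Sym n \<and> inversions \<sigma> \<subseteq> inversions \<rho>"
proof -
  have "(up_L n)\<^sup>*\<^sup>* \<sigma> \<rho> \<Longrightarrow> \<rho> \<in> Sym n \<and> inversions \<sigma> \<subseteq> inversions \<rho>" if "\<sigma> \<in> Sym n"
  proof (induction rule: rtranclp_induct)
    case (step \<tau> \<rho>)
    then show ?case using inversions_simple_transp(1)[of \<tau> n] up_L_Sym[of n \<tau> \<rho>]
      by (auto simp: up_L_def)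
  qed (simp add: that)
  then show ?thesis
    using inversions_subset_imp_up_chain unfolding weak_L_iff_up_chain by blast
qed

text \<open>Passing to the inverse turns inverted pairs of positions into inverted pairs of values. Since the
  length is unchanged, this exchanges the covers of the two weak orders.\<close>

lemma card_inversions_inv:
  assumes s: "\<sigma> \<in> Sym n"
  shows "card (inversions (inv \<sigma>)) = card (inversions \<sigma>)"
proof -
  have "bij_betw (\<lambda>(i, j). (\<sigma> j, \<sigma> i)) (inversions \<sigma>) (inversions (inv \<sigma>))"
    using s by (intro bij_betwI[where g = "\<lambda>(i, j). (inv \<sigma> j, inv \<sigma> i)"])
      (auto simp: inversions_def)
  then show ?thesis by (simp add: bij_betw_same_card)
qed

lemma perm_len_inv: "\<sigma> \<in> Sym n \<Longrightarrow> perm_len n (inv \<sigma>) = perm_len n \<sigma>"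
  by (simp add: perm_len_eq_card_inversions Sym_inv card_inversions_inv)

lemma cover_R_imp_cover_L_inv:
  assumes s: "\<sigma> \<in> Sym n" and c: "cover_R n \<sigma> \<tau>"
  shows "cover_L n (inv \<sigma>) (inv \<tau>) \<and> \<tau> \<in> Sym n"
proof -
  from c obtain i where i: "i \<in> {1..<n}" and t: "\<tau> = \<sigma> \<circ> simple_transp i"
    and l: "perm_len n \<tau> > perm_len n \<sigma>" by (auto simp: cover_R_def)
  have tS: "\<tau> \<in> Sym n" unfolding t using s i by (intro Sym_comp simple_transp_in_Sym)
  have "inv \<tau> = simple_transp i \<circ> inv \<sigma>"
    unfolding t using Sym_inv_of_comp[OF s simple_transp_in_Sym[OF i]] by simp
  then show ?thesis using i l perm_len_inv[OF s] perm_len_inv[OF tS] tS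
    by (auto simp: cover_L_def)
qed

lemma cover_L_imp_cover_R_inv:
  assumes s: "\<sigma> \<in> Sym n" and c: "cover_L n \<sigma> \<tau>"
  shows "cover_R n (inv \<sigma>) (inv \<tau>) \<and> \<tau> \<in> Sym n"
proof -
  from c obtain i where i: "i \<in> {1..<n}" and t: "\<tau> = simple_transp i \<circ> \<sigma>"
    and l: "perm_len n \<tau> > perm_len n \<sigma>" by (auto simp: cover_L_def)
  have tS: "\<tau> \<in> Sym n" unfolding t using s i by (intro Sym_comp simple_transp_in_Sym)
  have "inv \<tau> = inv \<sigma> \<circ> simple_transp i"
    unfolding t using Sym_inv_of_comp[OF simple_transp_in_Sym[OF i] s] by simp
  then show ?thesis using i l perm_len_inv[OF s] perm_len_inv[OF tS] tS
    by (auto simp: cover_R_def)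
qed

lemma weak_R_iff_weak_L_inv:
  assumes s: "\<sigma> \<in> Sym n" and r: "\<rho> \<in> Sym n"
  shows "weak_R n \<sigma> \<rho> \<longleftrightarrow> weak_L n (inv \<sigma>) (inv \<rho>)"
proof -
  have "(cover_R n)\<^sup>*\<^sup>* \<sigma> \<tau> \<Longrightarrow> \<tau> \<in> Sym n \<and> (cover_L n)\<^sup>*\<^sup>* (inv \<sigma>) (inv \<tau>)" for \<tau>
    by (induction rule: rtranclp_induct)
      (use s cover_R_imp_cover_L_inv in \<open>auto intro: rtranclp.rtrancl_into_rtrancl\<close>)
  moreover have "(cover_L n)\<^sup>*\<^sup>* (inv \<sigma>) \<tau> \<Longrightarrow> \<tau> \<in> Sym n \<and> (cover_R n)\<^sup>*\<^sup>* \<sigma> (inv \<tau>)" for \<tau>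
  proof (induction rule: rtranclp_induct)
    case base
    then show ?case using s by (simp add: Sym_inv Sym_inv_inv)
  next
    case (step \<tau> \<upsilon>)
    then show ?case using cover_L_imp_cover_R_inv[of \<tau> n \<upsilon>]
      by (auto intro: rtranclp.rtrancl_into_rtrancl)
  qed
  ultimately show ?thesis
    using s r unfolding weak_L_def weak_R_def by (metis Sym_inv Sym_inv_inv)
qed

theorem weak_R_iff_inversions:
  "weak_R n \<sigma> \<rho> \<longleftrightarrow> \<sigma> \<in> Sym n \<and> \<rho> \<in> Sym n \<and> inversions (inv \<sigma>) \<subseteq> inversions (inv \<rho>)"
  using weak_R_iff_weak_L_inv[of \<sigma> n \<rho>] weak_L_iff_inversions[of n "inv \<sigma>" "inv \<rho>"]
  by (auto simp: weak_R_def Sym_inv)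

section \<open>Linear extensions of regular relations\<close>

text \<open>Reading \<open>(x, y) \<in> R\<close> as a demand that the value \<open>x\<close> occur before the value \<open>y\<close> in the word
  \<open>\<sigma> 1, \<dots>, \<sigma> n\<close>, the set consists of the words of all linear extensions of \<open>R\<close>.\<close>

definition lin_ext :: "nat \<Rightarrow> (nat \<times> nat) set \<Rightarrow> (nat \<Rightarrow> nat) set" where
  "lin_ext n R = {\<sigma> \<in> Sym n. \<forall>x y. (x, y) \<in> R \<longrightarrow> inv \<sigma> x < inv \<sigma> y}"

lemma lin_ext_trancl:
  assumes "\<sigma> \<in> lin_ext n R" "(x, y) \<in> R\<^sup>+"
  shows "inv \<sigma> x < inv \<sigma> y"
  using assms(2)
proof (induction rule: trancl_induct)
  case (base y)
  then show ?case using assms(1) unfolding lin_ext_def by blast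
next
  case (step y z)
  from step.hyps(2) assms(1) have "inv \<sigma> y < inv \<sigma> z" unfolding lin_ext_def by blast
  with step.IH show ?case by simp
qed

definition between :: "nat \<Rightarrow> nat \<Rightarrow> nat \<Rightarrow> bool" where
  "between a b c \<longleftrightarrow> a < b \<and> b < c \<or> c < b \<and> b < a"

text \<open>This is the condition of Bjorner and Wachs that characterises the posets whose linear extensions
  form a weak order interval, stated for a generating relation of the poset: a label strictly
  between two related labels has to be related to one of them. If it is related to \<open>x\<close>, say, with
  \<open>(x, y) \<in> R\<close>, then either it follows \<open>x\<close>, or it precedes \<open>x\<close> and hence \<open>y\<close>.\<close>

definition regular_rel :: "(nat \<times> nat) set \<Rightarrow> bool" where
  "regular_rel R \<longleftrightarrow> (\<forall>x y b. (x, y) \<in> R \<longrightarrow> between x b y \<longrightarrow>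
     (x, b) \<in> R \<or> (b, x) \<in> R \<or> (b, y) \<in> R \<or> (y, b) \<in> R)"

text \<open>A chain of related labels from \<open>x\<close> to \<open>y\<close> cannot pass the label \<open>b\<close> without either visiting it or
  jumping over it in a single step, and regularity of that step suffices.\<close>

lemma regular_rel_trancl:
  assumes reg: "regular_rel R" and "(x, y) \<in> R\<^sup>+" "between x b y"
  shows "(x, b) \<in> R\<^sup>+ \<or> (b, y) \<in> R\<^sup>+"
proof -
  have gen: "(x, b) \<in> R\<^sup>+ \<or> (b, y) \<in> R\<^sup>+" if xy: "(x, y) \<in> R" and "between x b y" for x y
  proof -
    from that reg have "(x, b) \<in> R \<or> (b, x) \<in> R \<or> (b, y) \<in> R \<or> (y, b) \<in> R"
      unfolding regular_rel_def by blast
    with xy show ?thesis by (meson r_into_trancl trancl_into_trancl)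
  qed
  show ?thesis
    using assms(2,3)
  proof (induction rule: trancl_induct)
    case (base y)
    then show ?case by (rule gen)
  next
    case (step y z)
    from step.prems consider "b = y" | "between x b y" | "between y b z"
      unfolding between_def by linarith
    then show ?case
    proof cases
      case 1
      with step show ?thesis by simp
    next
      case 2
      with step show ?thesis by (meson trancl_into_trancl)
    next
      case 3
      with gen[OF step.hyps(2)] step.hyps show ?thesis by (meson trancl_trans)
    qed
  qed
qed

text \<open>A linear extension minimising the number of pairs that are out of order with respect to \<open>lt\<close> has
  no such pair beyond those forced by \<open>R\<close>. For two labels in adjacent positions, exchanging them
  would otherwise give a better linear extension. For a pair further apart, the label \<open>b\<close> next to
  the first of the two is compared with both: if \<open>b\<close> lies between them, two closer pairs
  combine, and otherwise one closer pair is forced and regularity transfers this to the given pair.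
  With \<open>lt\<close> as \<open><\<close> the minimiser has the fewest inversions of values, and with \<open>lt\<close> as \<open>>\<close> the most.\<close>

lemma extremal_lin_ext:
  fixes lt :: "nat \<Rightarrow> nat \<Rightarrow> bool"
  assumes lt: "lt = (<) \<or> lt = (>)" and reg: "regular_rel R" and ne: "lin_ext n R \<noteq> {}"
  shows "\<exists>\<sigma>\<in>lin_ext n R. \<forall>a\<in>{1..n}. \<forall>c\<in>{1..n}. lt a c \<longrightarrow> inv \<sigma> c < inv \<sigma> a \<longrightarrow> (c, a) \<in> R\<^sup>+"
proof -
  define D where "D \<sigma> = {(a, c). a \<in> {1..n} \<and> c \<in> {1..n} \<and> lt a c \<and> inv \<sigma> c < inv \<sigma> a}"
    for \<sigma> :: "nat \<Rightarrow> nat"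
  have finD: "finite (D \<sigma>)" for \<sigma>
    by (rule finite_subset[of _ "{1..n} \<times> {1..n}"]) (auto simp: D_def)
  obtain \<sigma> where \<sigma>: "\<sigma> \<in> lin_ext n R" and least: "\<And>\<tau>. \<tau> \<in> lin_ext n R \<Longrightarrow> card (D \<sigma>) \<le> card (D \<tau>)"
    using ne ex_has_least_nat[of "\<lambda>\<sigma>. \<sigma> \<in> lin_ext n R" _ "\<lambda>\<sigma>. card (D \<sigma>)"] by blast
  then have s: "\<sigma> \<in> Sym n" and ext: "\<And>x y. (x, y) \<in> R \<Longrightarrow> inv \<sigma> x < inv \<sigma> y"
    by (auto simp: lin_ext_def)
  have adjacent: "(c, a) \<in> R"
    if ac: "a \<in> {1..n}" "c \<in> {1..n}" "lt a c" and adj: "inv \<sigma> a = Suc (inv \<sigma> c)" for a c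
  proof (rule ccontr)
    assume notR: "(c, a) \<notin> R"
    define k where "k = inv \<sigma> c"
    have "k \<in> {1..n}" "Suc k \<in> {1..n}"
      using Sym_range_iff[OF Sym_inv[OF s]] ac adj unfolding k_def by metis+
    then have k: "k \<in> {1..<n}" by simp
    define \<tau> where "\<tau> = \<sigma> \<circ> simple_transp k"
    have tS: "\<tau> \<in> Sym n" unfolding \<tau>_def using s k by (intro Sym_comp simple_transp_in_Sym)
    have inv_t: "inv \<tau> x = simple_transp k (inv \<sigma> x)" for x
      unfolding \<tau>_def using Sym_inv_of_comp[OF s simple_transp_in_Sym[OF k]] by simp
    have posk: "inv \<sigma> x = k \<longleftrightarrow> x = c" "inv \<sigma> x = Suc k \<longleftrightarrow> x = a" for x
      using Sym_eq_iff[OF Sym_inv[OF s]] adj unfolding k_def by metis+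
    have keep: "inv \<tau> x < inv \<tau> y \<longleftrightarrow> inv \<sigma> x < inv \<sigma> y"
      if "(x, y) \<noteq> (c, a)" "(x, y) \<noteq> (a, c)" for x y
      using that posk[of x] posk[of y] unfolding inv_t
      by (auto simp: simple_transp_def transpose_def)
    have ca: "inv \<tau> a < inv \<tau> c" "inv \<sigma> c < inv \<sigma> a"
      using posk[of a] posk[of c] adj unfolding inv_t by auto
    have "\<tau> \<in> lin_ext n R"
      unfolding lin_ext_def
    proof (clarsimp simp: tS)
      fix x y assume xy: "(x, y) \<in> R"
      then have "(x, y) \<noteq> (c, a)" "(x, y) \<noteq> (a, c)" using notR ext[OF xy] ca by auto
      with ext[OF xy] keep show "inv \<tau> x < inv \<tau> y" by blast
    qed
    moreover have "D \<tau> \<subset> D \<sigma>"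
    proof
      show "D \<tau> \<subseteq> D \<sigma>"
      proof
        fix p assume "p \<in> D \<tau>"
        then obtain x y where p: "p = (x, y)" and xy: "x \<in> {1..n}" "y \<in> {1..n}" "lt x y"
          and inv: "inv \<tau> y < inv \<tau> x" by (auto simp: D_def)
        have "(y, x) \<noteq> (a, c)" using xy ac lt by auto
        moreover have "(y, x) \<noteq> (c, a)" using inv ca by auto
        ultimately show "p \<in> D \<sigma>" using keep inv xy p by (simp add: D_def)
      qed
      show "D \<tau> \<noteq> D \<sigma>"
      proof
        assume "D \<tau> = D \<sigma>"
        moreover have "(a, c) \<in> D \<sigma>" using ac ca by (simp add: D_def)
        ultimately have "(a, c) \<in> D \<tau>" by simp
        with ca show False by (simp add: D_def)
      qed
    qed
    ultimately show False using least finD psubset_card_mono by (metis not_less)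
  qed
  have "(c, a) \<in> R\<^sup>+"
    if "a \<in> {1..n}" "c \<in> {1..n}" "lt a c" "inv \<sigma> c < inv \<sigma> a" for a c
    using that
  proof (induction "inv \<sigma> a - inv \<sigma> c" arbitrary: a c rule: less_induct)
    case less
    show ?case
    proof (cases "inv \<sigma> a = Suc (inv \<sigma> c)")
      case True
      then show ?thesis using adjacent less by blast
    next
      case False
      \<comment> \<open>the label immediately after \<open>c\<close> in the word of \<open>\<sigma>\<close>, which precedes \<open>a\<close>\<close>
      define b where "b = \<sigma> (Suc (inv \<sigma> c))"
      have posb: "inv \<sigma> b = Suc (inv \<sigma> c)" using s by (simp add: b_def)
      then have cb: "inv \<sigma> c < inv \<sigma> b" and ba: "inv \<sigma> b < inv \<sigma> a"
        using False less.prems by auto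
      have "inv \<sigma> c \<in> {1..n}" "inv \<sigma> a \<in> {1..n}"
        using less.prems Sym_range_iff[OF Sym_inv[OF s]] by blast+
      then have b: "b \<in> {1..n}"
        using Sym_range_iff[OF Sym_inv[OF s], of b] cb ba by simp
      have dist: "b \<noteq> a" "b \<noteq> c" using cb ba by auto
      have IHcb: "(c, b) \<in> R\<^sup>+" if "lt b c" using less.hyps[of b c] less.prems b cb ba that by auto
      have IHba: "(b, a) \<in> R\<^sup>+" if "lt a b" using less.hyps[of a b] less.prems b cb ba that by auto
      consider "lt a b" "lt b c" | "lt b a" "lt a c" | "lt a c" "lt c b"
        using lt dist less.prems(3) by (elim disjE) (auto simp: nat_neq_iff)
      then show ?thesis
      proof cases
        case 1
        then show ?thesis using IHcb IHba by (meson trancl_trans)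
      next
        case 2
        then have "lt b c" "between c a b" using lt by (auto simp: between_def)
        then have "(c, a) \<in> R\<^sup>+ \<or> (a, b) \<in> R\<^sup>+" using regular_rel_trancl[OF reg IHcb] by blast
        moreover have "(a, b) \<notin> R\<^sup>+" using lin_ext_trancl[OF \<sigma>, of a b] ba by auto
        ultimately show ?thesis by blast
      next
        case 3
        then have "lt a b" "between b c a" using lt by (auto simp: between_def)
        then have "(b, c) \<in> R\<^sup>+ \<or> (c, a) \<in> R\<^sup>+" using regular_rel_trancl[OF reg IHba] by blast
        moreover have "(b, c) \<notin> R\<^sup>+" using lin_ext_trancl[OF \<sigma>, of b c] cb by auto
        ultimately show ?thesis by blast
      qed
    qed
  qed
  with \<sigma> show ?thesis by blast
qed

text \<open>The two extremal linear extensions bound all others, because their inversions, respectively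
  non-inversions, are forced. Conversely, each demand of \<open>R\<close> says that a certain pair is an
  inversion or that it is not, and both conditions are inherited by everything between two linear extensions.\<close>

theorem lin_ext_in_Int_R:
  assumes reg: "regular_rel R" and ne: "lin_ext n R \<noteq> {}"
  shows "lin_ext n R \<in> Int_R n"
proof -
  obtain \<sigma> where s: "\<sigma> \<in> lin_ext n R" and
    bot: "\<And>a c. a \<in> {1..n} \<Longrightarrow> c \<in> {1..n} \<Longrightarrow> a < c \<Longrightarrow> inv \<sigma> c < inv \<sigma> a \<Longrightarrow> (c, a) \<in> R\<^sup>+"
    using extremal_lin_ext[of "(<)", OF _ reg ne] by auto
  obtain \<rho> where r: "\<rho> \<in> lin_ext n R" and
    top: "\<And>a c. a \<in> {1..n} \<Longrightarrow> c \<in> {1..n} \<Longrightarrow> c < a \<Longrightarrow> inv \<rho> c < inv \<rho> a \<Longrightarrow> (c, a) \<in> R\<^sup>+"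
    using extremal_lin_ext[of "(>)", OF _ reg ne] by auto
  have Sym: "\<sigma> \<in> Sym n" "\<rho> \<in> Sym n" using s r by (auto simp: lin_ext_def)
  have least: "weak_R n \<sigma> \<gamma>" and greatest: "weak_R n \<gamma> \<rho>" if g: "\<gamma> \<in> lin_ext n R" for \<gamma>
  proof -
    have gS: "\<gamma> \<in> Sym n" using g by (simp add: lin_ext_def)
    have "inversions (inv \<sigma>) \<subseteq> inversions (inv \<gamma>)"
    proof
      fix p assume p: "p \<in> inversions (inv \<sigma>)"
      then obtain a c where ac: "p = (a, c)" "a < c" "inv \<sigma> c < inv \<sigma> a"
        by (auto simp: inversions_def)
      have "a \<in> {1..n}" "c \<in> {1..n}" using p ac inversions_subset[OF Sym_inv[OF Sym(1)]] by auto
      then have "inv \<gamma> c < inv \<gamma> a" using bot ac lin_ext_trancl[OF g] by blast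
      with ac show "p \<in> inversions (inv \<gamma>)" by (simp add: inversions_def)
    qed
    with gS Sym show "weak_R n \<sigma> \<gamma>" by (simp add: weak_R_iff_inversions)
    have "inversions (inv \<gamma>) \<subseteq> inversions (inv \<rho>)"
    proof
      fix p assume p: "p \<in> inversions (inv \<gamma>)"
      then obtain a c where ac: "p = (a, c)" "a < c" "inv \<gamma> c < inv \<gamma> a"
        by (auto simp: inversions_def)
      have "a \<in> {1..n}" "c \<in> {1..n}" using p ac inversions_subset[OF Sym_inv[OF gS]] by auto
      then have "\<not> inv \<rho> a < inv \<rho> c" using top[of c a] ac lin_ext_trancl[OF g, of a c] by auto
      moreover have "inv \<rho> a \<noteq> inv \<rho> c" using ac Sym_eq_iff[OF Sym_inv[OF Sym(2)]] by simp
      ultimately show "p \<in> inversions (inv \<rho>)" using ac by (simp add: inversions_def)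
    qed
    with gS Sym show "weak_R n \<gamma> \<rho>" by (simp add: weak_R_iff_inversions)
  qed
  have "\<gamma> \<in> lin_ext n R" if "weak_R n \<sigma> \<gamma>" "weak_R n \<gamma> \<rho>" for \<gamma>
  proof -
    have gS: "\<gamma> \<in> Sym n" and sub: "inversions (inv \<sigma>) \<subseteq> inversions (inv \<gamma>)"
      "inversions (inv \<gamma>) \<subseteq> inversions (inv \<rho>)"
      using that by (auto simp: weak_R_iff_inversions)
    have "inv \<gamma> x < inv \<gamma> y" if xy: "(x, y) \<in> R" for x y
    proof -
      have ext: "inv \<sigma> x < inv \<sigma> y" "inv \<rho> x < inv \<rho> y" using s r xy by (auto simp: lin_ext_def)
      then have "x \<noteq> y" by auto
      then have neq: "inv \<gamma> x \<noteq> inv \<gamma> y" using Sym_eq_iff[OF Sym_inv[OF gS]] by simp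
      show ?thesis
      proof (cases "x < y")
        case True
        then have "\<not> inv \<gamma> y < inv \<gamma> x"
          using subsetD[OF sub(2), of "(x, y)"] ext by (auto simp: inversions_def)
        with neq show ?thesis by simp
      next
        case False
        then show ?thesis using subsetD[OF sub(1), of "(y, x)"] ext \<open>x \<noteq> y\<close> by (auto simp: inversions_def)
      qed
    qed
    with gS show ?thesis by (auto simp: lin_ext_def)
  qed
  with least greatest have "lin_ext n R = interval_R n \<sigma> \<rho>"
    by (auto simp: interval_R_def)
  with Sym least[OF r] show ?thesis unfolding Int_R_def by blast
qed

section \<open>Left intervals as right translates of lower intervals\<close>

lemma weak_L_refl: "\<sigma> \<in> Sym n \<Longrightarrow> weak_L n \<sigma> \<sigma>"
  by (simp add: weak_L_iff_inversions)

lemma weak_L_trans: "weak_L n \<sigma> \<tau> \<Longrightarrow> weak_L n \<tau> \<rho> \<Longrightarrow> weak_L n \<sigma> \<rho>"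
  by (auto simp: weak_L_iff_inversions)

lemma weak_L_Sym: "weak_L n \<sigma> \<rho> \<Longrightarrow> \<sigma> \<in> Sym n \<and> \<rho> \<in> Sym n"
  by (simp add: weak_L_def)

lemma up_L_imp_weak_L: "up_L n \<sigma> \<tau> \<Longrightarrow> \<sigma> \<in> Sym n \<Longrightarrow> weak_L n \<sigma> \<tau>"
  by (auto simp: weak_L_iff_up_chain up_L_Sym)

lemma weak_L_eq_or_card_less:
  assumes "weak_L n \<sigma> \<rho>"
  shows "\<sigma> = \<rho> \<or> card (inversions \<sigma>) < card (inversions \<rho>)"
proof (cases "inversions \<sigma> = inversions \<rho>")
  case True
  from assms have "\<sigma> \<in> Sym n" "(up_L n)\<^sup>*\<^sup>* \<sigma> \<rho>" by (auto simp: weak_L_iff_up_chain)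
  from this(2,1) show ?thesis
  proof (cases rule: converse_rtranclpE)
    case (step \<tau>)
    then have "weak_L n \<tau> \<rho>" using assms up_L_Sym by (auto simp: weak_L_iff_up_chain)
    then have "card (inversions \<tau>) \<le> card (inversions \<rho>)"
      by (intro card_mono finite_inversions[of _ n]) (auto simp: weak_L_iff_inversions)
    with up_L_card_inversions[OF step(1)] step show ?thesis
      using \<open>\<sigma> \<in> Sym n\<close> by simp
  qed simp
next
  case False
  with assms show ?thesis
    by (auto simp: weak_L_iff_inversions intro!: psubset_card_mono finite_inversions)
qed

lemma weak_L_antisym: "weak_L n \<sigma> \<rho> \<Longrightarrow> weak_L n \<rho> \<sigma> \<Longrightarrow> \<sigma> = \<rho>"
  using weak_L_eq_or_card_less by (metis less_asym)

text \<open>Comparing right multiples of \<open>\<sigma>\<close>, positions are renamed by the values that \<open>\<sigma>\<close> has there.\<close>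

lemma weak_L_right_mult_iff:
  assumes s: "\<sigma> \<in> Sym n" and u: "u \<in> Sym n" and v: "v \<in> Sym n"
  shows "weak_L n (u \<circ> \<sigma>) (v \<circ> \<sigma>) \<longleftrightarrow>
    (\<forall>x y. inv \<sigma> x < inv \<sigma> y \<longrightarrow> u y < u x \<longrightarrow> v y < v x)"
proof -
  have "inversions (u \<circ> \<sigma>) \<subseteq> inversions (v \<circ> \<sigma>) \<longleftrightarrow>
    (\<forall>i j. i < j \<longrightarrow> u (\<sigma> j) < u (\<sigma> i) \<longrightarrow> v (\<sigma> j) < v (\<sigma> i))"
    by (auto simp: inversions_def)
  also have "\<dots> \<longleftrightarrow> (\<forall>x y. inv \<sigma> x < inv \<sigma> y \<longrightarrow> u y < u x \<longrightarrow> v y < v x)"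
    by (metis Sym_apply_inv[OF s] Sym_inv_apply[OF s])
  finally show ?thesis using Sym_comp[OF u s] Sym_comp[OF v s] by (simp add: weak_L_iff_inversions)
qed

lemma weak_L_iff: "weak_L n u v \<longleftrightarrow> u \<in> Sym n \<and> v \<in> Sym n \<and> (\<forall>x y. x < y \<longrightarrow> u y < u x \<longrightarrow> v y < v x)"
  by (auto simp: weak_L_iff_inversions inversions_def)

text \<open>The condition \<open>\<ell>(\<xi> \<sigma>) = \<ell>(\<xi>) + \<ell>(\<sigma>)\<close>, expressed through inversions: no pair of values that \<open>\<xi>\<close>
  inverts is already out of order in \<open>\<sigma>\<close>.\<close>

definition length_additive :: "(nat \<Rightarrow> nat) \<Rightarrow> (nat \<Rightarrow> nat) \<Rightarrow> bool" where
  "length_additive \<xi> \<sigma> \<longleftrightarrow> (\<forall>x y. x < y \<longrightarrow> \<xi> y < \<xi> x \<longrightarrow> inv \<sigma> x < inv \<sigma> y)"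

lemma weak_L_imp_length_additive:
  assumes "weak_L n \<sigma> \<rho>"
  shows "length_additive (\<rho> \<circ> inv \<sigma>) \<sigma>"
  unfolding length_additive_def
proof (intro allI impI)
  fix x y :: nat assume xy: "x < y" "(\<rho> \<circ> inv \<sigma>) y < (\<rho> \<circ> inv \<sigma>) x"
  have s: "\<sigma> \<in> Sym n" using weak_L_Sym[OF assms] by simp
  show "inv \<sigma> x < inv \<sigma> y"
  proof (rule ccontr)
    assume "\<not> inv \<sigma> x < inv \<sigma> y"
    moreover have "inv \<sigma> x \<noteq> inv \<sigma> y" using xy by auto
    ultimately have "inv \<sigma> y < inv \<sigma> x" by simp
    moreover have "\<sigma> (inv \<sigma> x) < \<sigma> (inv \<sigma> y)" using s xy by simp
    ultimately have "\<rho> (inv \<sigma> x) < \<rho> (inv \<sigma> y)" using assms unfolding weak_L_iff by blast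
    with xy show False by simp
  qed
qed

text \<open>A pair of values already out of order in \<open>\<sigma>\<close> is not inverted by \<open>\<xi>\<close>, hence neither by \<open>u\<close> nor by \<open>v\<close>,
  so it contributes an inversion to both products. On the remaining pairs, the inversions of a
  product are those of its left factor.\<close>

lemma weak_L_right_mult_mono_iff:
  assumes s: "\<sigma> \<in> Sym n" and add: "length_additive \<xi> \<sigma>" and u: "weak_L n u \<xi>" and v: "weak_L n v \<xi>"
  shows "weak_L n (u \<circ> \<sigma>) (v \<circ> \<sigma>) \<longleftrightarrow> weak_L n u v"
proof -
  have uS: "u \<in> Sym n" "v \<in> Sym n" using u v weak_L_Sym by blast+
  have before: "inv \<sigma> x < inv \<sigma> y" if "x < y" "u y < u x \<or> v y < v x" for x y
    using that u v add unfolding weak_L_iff length_additive_def by blast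
  have "(\<forall>x y. inv \<sigma> x < inv \<sigma> y \<longrightarrow> u y < u x \<longrightarrow> v y < v x) \<longleftrightarrow>
        (\<forall>x y. x < y \<longrightarrow> u y < u x \<longrightarrow> v y < v x)" (is "?L \<longleftrightarrow> ?R")
  proof
    assume ?L
    then show ?R using before by blast
  next
    assume R: ?R
    show ?L
    proof (intro allI impI)
      fix x y assume xy: "inv \<sigma> x < inv \<sigma> y" "u y < u x"
      then have neq: "x \<noteq> y" by auto
      show "v y < v x"
      proof (cases "x < y")
        case True
        with R xy show ?thesis by blast
      next
        case False
        with neq have "y < x" by simp
        then have "\<not> v x < v y" using before[of y x] xy by auto
        moreover have "v x \<noteq> v y" using neq Sym_eq_iff[OF uS(2)] by simp
        ultimately show ?thesis by simp
      qed
    qed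
  qed
  then show ?thesis using weak_L_right_mult_iff[OF s uS] uS by (simp add: weak_L_iff)
qed

lemma weak_L_id: "\<xi> \<in> Sym n \<Longrightarrow> weak_L n id \<xi>"
  by (simp add: weak_L_iff Sym_id)

text \<open>The interval between \<open>\<sigma>\<close> and \<open>\<xi> \<sigma>\<close> is a copy of the interval between \<open>id\<close> and \<open>\<xi>\<close>. All intervals
  sharing the quotient \<open>\<xi>\<close> of their endpoints are thereby isomorphic, and what can distinguish them
  is only their descents.\<close>

lemma interval_L_right_mult:
  assumes s: "\<sigma> \<in> Sym n" and x: "\<xi> \<in> Sym n" and add: "length_additive \<xi> \<sigma>"
  shows "interval_L n \<sigma> (\<xi> \<circ> \<sigma>) = (\<lambda>u. u \<circ> \<sigma>) ` {u. weak_L n u \<xi>}"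
proof (intro equalityI subsetI)
  fix \<gamma> assume "\<gamma> \<in> (\<lambda>u. u \<circ> \<sigma>) ` {u. weak_L n u \<xi>}"
  then obtain u where u: "weak_L n u \<xi>" "\<gamma> = u \<circ> \<sigma>" by blast
  have "weak_L n (id \<circ> \<sigma>) \<gamma>" "weak_L n \<gamma> (\<xi> \<circ> \<sigma>)"
    using weak_L_right_mult_mono_iff[OF s add] weak_L_id[OF x] weak_L_refl[OF x] u weak_L_Sym[OF u(1)]
    by (simp_all only: weak_L_id)
  then show "\<gamma> \<in> interval_L n \<sigma> (\<xi> \<circ> \<sigma>)" by (simp add: interval_L_def)
next
  fix \<gamma> assume g: "\<gamma> \<in> interval_L n \<sigma> (\<xi> \<circ> \<sigma>)"
  define u where "u = \<gamma> \<circ> inv \<sigma>"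
  have gS: "\<gamma> \<in> Sym n" using g by (auto simp: interval_L_def weak_L_def)
  then have uS: "u \<in> Sym n" unfolding u_def using s by (intro Sym_comp Sym_inv)
  have gu: "\<gamma> = u \<circ> \<sigma>" unfolding u_def using s by (simp add: comp_assoc)
  have up: "inv \<sigma> x < inv \<sigma> y \<Longrightarrow> y < x \<Longrightarrow> u y < u x"
    and below: "inv \<sigma> x < inv \<sigma> y \<Longrightarrow> u y < u x \<Longrightarrow> \<xi> y < \<xi> x" for x y
    using g weak_L_right_mult_iff[OF s Sym_id uS] weak_L_right_mult_iff[OF s uS x]
    unfolding interval_L_def gu by auto
  have "weak_L n u \<xi>"
    unfolding weak_L_iff
  proof (intro conjI uS x allI impI)
    fix a b assume ab: "a < b" "u b < u a"
    have "inv \<sigma> a \<noteq> inv \<sigma> b" using Sym_eq_iff[OF Sym_inv[OF s]] ab by simp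
    with ab up[of b a] have "inv \<sigma> a < inv \<sigma> b" by force
    with ab below show "\<xi> b < \<xi> a" by blast
  qed
  with gu show "\<gamma> \<in> (\<lambda>u. u \<circ> \<sigma>) ` {u. weak_L n u \<xi>}" by blast
qed

section \<open>The relation read off from the descents\<close>

text \<open>The number \<open>i\<close> is a left descent of \<open>u \<sigma>\<close> exactly if the value \<open>u\<inverse> (i + 1)\<close> occurs before \<open>u\<inverse> i\<close>
  in \<open>\<sigma>\<close>. Hence the descent sets of all \<open>u \<sigma>\<close> with \<open>u\<close> below \<open>\<xi>\<close> record the order in \<open>\<sigma>\<close> of precisely
  those pairs of values that some such \<open>u\<close> makes adjacent; this relation lists these pairs in the
  order in which \<open>\<sigma>\<close> has them.\<close>

definition adjacency_rel :: "nat \<Rightarrow> (nat \<Rightarrow> nat) \<Rightarrow> (nat \<Rightarrow> nat) \<Rightarrow> (nat \<times> nat) set" where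
  "adjacency_rel n \<xi> \<sigma> = {(x, y). x \<in> {1..n} \<and> y \<in> {1..n} \<and> inv \<sigma> x < inv \<sigma> y \<and>
     (\<exists>u. weak_L n u \<xi> \<and> (u y = Suc (u x) \<or> u x = Suc (u y)))}"

text \<open>On a chain of covers from \<open>id\<close> to \<open>\<xi>\<close> the pair has to be exchanged at some step, and a cover
  exchanges only two adjacent values.\<close>

lemma inversion_becomes_adjacent:
  assumes "(up_L n)\<^sup>*\<^sup>* id \<xi>" "x < y" "\<xi> y < \<xi> x"
  shows "\<exists>u. weak_L n u \<xi> \<and> u y = Suc (u x)"
  using assms
proof (induction rule: rtranclp_induct)
  case (step \<tau> \<xi>)
  then have tS: "\<tau> \<in> Sym n" using up_chain_word by blast
  then have le: "weak_L n \<tau> \<xi>" using step.hyps by (simp add: up_L_imp_weak_L)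
  show ?case
  proof (cases "\<tau> y < \<tau> x")
    case True
    with step show ?thesis using le weak_L_trans by blast
  next
    case False
    moreover have "\<tau> x \<noteq> \<tau> y" using Sym_eq_iff[OF tS] step.prems by simp
    moreover obtain i where "\<xi> = simple_transp i \<circ> \<tau>" using step.hyps by (auto simp: up_L_def)
    ultimately have "\<tau> y = Suc (\<tau> x)" using step.prems
      by (auto simp: simple_transp_def transpose_def split: if_splits)
    with le show ?thesis by blast
  qed
qed simp

lemma inversion_in_adjacency_rel:
  assumes x: "\<xi> \<in> Sym n" and add: "length_additive \<xi> \<sigma>" and ab: "a < b" "\<xi> b < \<xi> a"
  shows "(a, b) \<in> adjacency_rel n \<xi> \<sigma>"
proof -
  have "(a, b) \<in> inversions \<xi>" using ab by (simp add: inversions_def)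
  then have "a \<in> {1..n}" "b \<in> {1..n}" using inversions_subset[OF x] by auto
  moreover have "\<exists>u. weak_L n u \<xi> \<and> u b = Suc (u a)"
    using inversion_becomes_adjacent[of n \<xi> a b] weak_L_id[OF x] ab
    by (simp add: weak_L_iff_up_chain)
  ultimately show ?thesis using add ab by (auto simp: adjacency_rel_def length_additive_def)
qed

text \<open>Two elements below \<open>\<xi>\<close> can disagree only on a pair that is inverted by one of them, and thus by \<open>\<xi>\<close>.\<close>

lemma adjacency_rel_if_order_differs:
  assumes x: "\<xi> \<in> Sym n" and add: "length_additive \<xi> \<sigma>" and u: "weak_L n u \<xi>" and v: "weak_L n v \<xi>"
    and diff: "(u a < u b) \<noteq> (v a < v b)"
  shows "(a, b) \<in> adjacency_rel n \<xi> \<sigma> \<or> (b, a) \<in> adjacency_rel n \<xi> \<sigma>"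
proof -
  have inj: "u a = u b \<longleftrightarrow> a = b" "v a = v b \<longleftrightarrow> a = b"
    using Sym_eq_iff weak_L_Sym u v by blast+
  then have "a \<noteq> b" using diff by auto
  then consider "a < b" | "b < a" by linarith
  then show ?thesis
  proof cases
    case 1
    then have "u b < u a \<or> v b < v a" using diff inj by force
    with 1 u v have "\<xi> b < \<xi> a" unfolding weak_L_iff by blast
    with 1 show ?thesis using inversion_in_adjacency_rel[OF x add] by blast
  next
    case 2
    then have "u a < u b \<or> v a < v b" using diff by blast
    with 2 u v have "\<xi> a < \<xi> b" unfolding weak_L_iff by blast
    with 2 show ?thesis using inversion_in_adjacency_rel[OF x add] by blast
  qed
qed

text \<open>Let \<open>u\<close> make \<open>x\<close> and \<open>y\<close> adjacent and let \<open>v b\<close> lie strictly between \<open>v x\<close> and \<open>v y\<close>. Nothing lies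
  between \<open>u x\<close> and \<open>u y\<close>, so \<open>u\<close> and \<open>v\<close> order \<open>b\<close> differently relative to \<open>x\<close> or to \<open>y\<close>. The case
  \<open>v = id\<close> serves for the minima of a class and \<open>v = \<xi>\<close> for its maxima.\<close>

lemma regular_adjacency_rel:
  assumes x: "\<xi> \<in> Sym n" and add: "length_additive \<xi> \<sigma>" and v: "weak_L n v \<xi>"
  shows "regular_rel (map_prod v v ` adjacency_rel n \<xi> \<sigma>)"
  unfolding regular_rel_def
proof (intro allI impI)
  fix x' y' b'
  assume "(x', y') \<in> map_prod v v ` adjacency_rel n \<xi> \<sigma>" and betw: "between x' b' y'"
  then obtain x y where xy: "(x, y) \<in> adjacency_rel n \<xi> \<sigma>" and x': "x' = v x" and y': "y' = v y"
    by auto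
  then obtain u where u: "weak_L n u \<xi>" and adj: "u y = Suc (u x) \<or> u x = Suc (u y)"
    by (auto simp: adjacency_rel_def)
  have uS: "u \<in> Sym n" and vS: "v \<in> Sym n" using u v weak_L_Sym by blast+
  define b where "b = inv v b'"
  have b': "b' = v b" using vS by (simp add: b_def)
  have "b \<noteq> x" "b \<noteq> y" using betw unfolding between_def x' y' b' by auto
  then have "u b \<noteq> u x" "u b \<noteq> u y" using Sym_eq_iff[OF uS] by blast+
  with adj betw have "(u x < u b) \<noteq> (v x < v b) \<or> (u b < u y) \<noteq> (v b < v y)"
    unfolding between_def x' y' b' by auto
  then have "(x, b) \<in> adjacency_rel n \<xi> \<sigma> \<or> (b, x) \<in> adjacency_rel n \<xi> \<sigma> \<or>
             (b, y) \<in> adjacency_rel n \<xi> \<sigma> \<or> (y, b) \<in> adjacency_rel n \<xi> \<sigma>"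
    using adjacency_rel_if_order_differs[OF x add u v] by blast
  then show "(x', b') \<in> map_prod v v ` adjacency_rel n \<xi> \<sigma> \<or>
    (b', x') \<in> map_prod v v ` adjacency_rel n \<xi> \<sigma> \<or>
    (b', y') \<in> map_prod v v ` adjacency_rel n \<xi> \<sigma> \<or>
    (y', b') \<in> map_prod v v ` adjacency_rel n \<xi> \<sigma>"
    unfolding x' y' b' by (metis map_prod_imageI)
qed

section \<open>Descent-preserving isomorphisms are right translations\<close>

lemma inv_right_mult_apply: "u \<in> Sym n \<Longrightarrow> \<sigma> \<in> Sym n \<Longrightarrow> inv (u \<circ> \<sigma>) x = inv \<sigma> (inv u x)"
  using Sym_inv_of_comp by fastforce

text \<open>The isomorphism is \<open>u \<sigma>\<^sub>0 \<mapsto> u \<sigma>\<close>. Since \<open>adjacency_rel\<close> contains the inversions of \<open>\<xi>\<close>, a linear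
  extension of it is still length-additive with \<open>\<xi>\<close>, so that both intervals are translates of the
  same lower interval; that descents agree is what the relation was made for.\<close>

lemma D_equiv_if_lin_ext:
  assumes s0: "\<sigma>\<^sub>0 \<in> Sym n" and x: "\<xi> \<in> Sym n" and add0: "length_additive \<xi> \<sigma>\<^sub>0"
    and s: "\<sigma> \<in> lin_ext n (adjacency_rel n \<xi> \<sigma>\<^sub>0)"
  shows "(interval_L n \<sigma>\<^sub>0 (\<xi> \<circ> \<sigma>\<^sub>0), interval_L n \<sigma> (\<xi> \<circ> \<sigma>)) \<in> D_equiv n"
proof -
  have sS: "\<sigma> \<in> Sym n" and ext: "\<And>x y. (x, y) \<in> adjacency_rel n \<xi> \<sigma>\<^sub>0 \<Longrightarrow> inv \<sigma> x < inv \<sigma> y"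
    using s by (auto simp: lin_ext_def)
  have add: "length_additive \<xi> \<sigma>"
    unfolding length_additive_def using ext inversion_in_adjacency_rel[OF x add0] by blast
  note I0 = interval_L_right_mult[OF s0 x add0] and I = interval_L_right_mult[OF sS x add]
  define f where "f \<gamma> = \<gamma> \<circ> inv \<sigma>\<^sub>0 \<circ> \<sigma>" for \<gamma> :: "nat \<Rightarrow> nat"
  have f: "f (u \<circ> \<sigma>\<^sub>0) = u \<circ> \<sigma>" for u
  proof -
    have "f (u \<circ> \<sigma>\<^sub>0) = u \<circ> (\<sigma>\<^sub>0 \<circ> inv \<sigma>\<^sub>0) \<circ> \<sigma>" by (simp only: f_def comp_assoc)
    then show ?thesis using s0 by simp
  qed
  have in_Int: "interval_L n \<tau> (\<xi> \<circ> \<tau>) \<in> Int_L n" if t: "\<tau> \<in> Sym n" "length_additive \<xi> \<tau>" for \<tau>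
  proof -
    have "weak_L n (id \<circ> \<tau>) (\<xi> \<circ> \<tau>)"
      using weak_L_right_mult_mono_iff[OF t weak_L_id[OF x] weak_L_refl[OF x]] weak_L_id[OF x] by blast
    then show ?thesis unfolding Int_L_def using t Sym_comp[OF x t(1)] by auto
  qed
  have "bij_betw f (interval_L n \<sigma>\<^sub>0 (\<xi> \<circ> \<sigma>\<^sub>0)) (interval_L n \<sigma> (\<xi> \<circ> \<sigma>))"
    unfolding bij_betw_def
  proof
    show "inj_on f (interval_L n \<sigma>\<^sub>0 (\<xi> \<circ> \<sigma>\<^sub>0))"
    proof (rule inj_onI)
      fix \<gamma> \<delta>
      assume "\<gamma> \<in> interval_L n \<sigma>\<^sub>0 (\<xi> \<circ> \<sigma>\<^sub>0)" "\<delta> \<in> interval_L n \<sigma>\<^sub>0 (\<xi> \<circ> \<sigma>\<^sub>0)" and eq: "f \<gamma> = f \<delta>"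
      then obtain u v where uv: "\<gamma> = u \<circ> \<sigma>\<^sub>0" "\<delta> = v \<circ> \<sigma>\<^sub>0" unfolding I0 by blast
      then have "u \<circ> \<sigma> \<circ> inv \<sigma> = v \<circ> \<sigma> \<circ> inv \<sigma>" using eq f by simp
      with uv show "\<gamma> = \<delta>" using sS by (simp add: comp_assoc)
    qed
    show "f ` interval_L n \<sigma>\<^sub>0 (\<xi> \<circ> \<sigma>\<^sub>0) = interval_L n \<sigma> (\<xi> \<circ> \<sigma>)"
      unfolding I0 I image_image f ..
  qed
  moreover have "weak_L n \<gamma> \<delta> \<longleftrightarrow> weak_L n (f \<gamma>) (f \<delta>)"
    if "\<gamma> \<in> interval_L n \<sigma>\<^sub>0 (\<xi> \<circ> \<sigma>\<^sub>0)" "\<delta> \<in> interval_L n \<sigma>\<^sub>0 (\<xi> \<circ> \<sigma>\<^sub>0)" for \<gamma> \<delta>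
  proof -
    from that obtain u v where "weak_L n u \<xi>" "weak_L n v \<xi>" "\<gamma> = u \<circ> \<sigma>\<^sub>0" "\<delta> = v \<circ> \<sigma>\<^sub>0"
      unfolding I0 by blast
    then show ?thesis
      using weak_L_right_mult_mono_iff[OF s0 add0] weak_L_right_mult_mono_iff[OF sS add] f by simp
  qed
  ultimately have "poset_iso_L n (interval_L n \<sigma>\<^sub>0 (\<xi> \<circ> \<sigma>\<^sub>0)) (interval_L n \<sigma> (\<xi> \<circ> \<sigma>)) f"
    unfolding poset_iso_L_def by blast
  moreover have "Des_L n (u \<circ> \<sigma>\<^sub>0) = Des_L n (u \<circ> \<sigma>)" if u: "weak_L n u \<xi>" for u
  proof -
    have uS: "u \<in> Sym n" using weak_L_Sym[OF u] by simp
    have same: "inv \<sigma>\<^sub>0 (inv u (Suc i)) < inv \<sigma>\<^sub>0 (inv u i) \<longleftrightarrow> inv \<sigma> (inv u (Suc i)) < inv \<sigma> (inv u i)"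
      if i: "i \<in> {1..<n}" for i
    proof -
      have rng: "inv u i \<in> {1..n}" "inv u (Suc i) \<in> {1..n}"
        using i Sym_range_iff[OF Sym_inv[OF uS]] by simp_all
      have adj: "u (inv u (Suc i)) = Suc (u (inv u i))" using uS by simp
      have neq: "inv \<sigma>\<^sub>0 (inv u (Suc i)) \<noteq> inv \<sigma>\<^sub>0 (inv u i)"
        using Sym_eq_iff[OF Sym_inv] s0 uS by simp
      then consider "inv \<sigma>\<^sub>0 (inv u (Suc i)) < inv \<sigma>\<^sub>0 (inv u i)"
        | "inv \<sigma>\<^sub>0 (inv u i) < inv \<sigma>\<^sub>0 (inv u (Suc i))" by linarith
      then show ?thesis
      proof cases
        case 1
        then have "(inv u (Suc i), inv u i) \<in> adjacency_rel n \<xi> \<sigma>\<^sub>0"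
          unfolding adjacency_rel_def using rng adj u by blast
        with 1 ext show ?thesis by blast
      next
        case 2
        then have "(inv u i, inv u (Suc i)) \<in> adjacency_rel n \<xi> \<sigma>\<^sub>0"
          unfolding adjacency_rel_def using rng adj u by blast
        with 2 ext show ?thesis by (metis less_asym)
      qed
    qed
    show ?thesis
      using same by (auto simp only: Des_L_iff Sym_comp[OF uS] s0 sS inv_right_mult_apply[OF uS])
  qed
  then have "descent_preserving n (interval_L n \<sigma>\<^sub>0 (\<xi> \<circ> \<sigma>\<^sub>0)) f"
    unfolding descent_preserving_def I0 by (metis (no_types, lifting) f imageE mem_Collect_eq)
  ultimately show ?thesis
    unfolding D_equiv_def using in_Int[OF s0 add0] in_Int[OF sS add] by blast
qed

text \<open>The label of a cover can be recovered from the descent sets of its two ends. Besides \<open>j\<close> itself only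
  its neighbours can change their status, and ascents there survive: in \<open>\<delta>\<close> the value \<open>j\<close> occurs before
  \<open>j + 1\<close>, so the step moves \<open>j + 1\<close> to an earlier place, still before \<open>j + 2\<close>, and moves \<open>j\<close> to a later
  place, still after \<open>j - 1\<close>.\<close>

lemma label_unique:
  assumes d: "\<delta> \<in> Sym n" and j: "j \<in> {1..<n}" and up: "inv \<delta> j < inv \<delta> (Suc j)"
    and i: "i \<in> Des_L n (simple_transp j \<circ> \<delta>)" "i \<notin> Des_L n \<delta>"
  shows "i = j"
proof (rule ccontr)
  assume neq: "i \<noteq> j"
  have t: "simple_transp j \<circ> \<delta> \<in> Sym n" using d j by (intro Sym_comp simple_transp_in_Sym)
  have inv_t: "inv (simple_transp j \<circ> \<delta>) x = inv \<delta> (simple_transp j x)" for x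
    using inv_right_mult_apply[OF simple_transp_in_Sym[OF j] d] by simp
  have i': "inv \<delta> (simple_transp j (Suc i)) < inv \<delta> (simple_transp j i)"
    "inv \<delta> i \<le> inv \<delta> (Suc i)"
    using i unfolding Des_L_iff[OF t] Des_L_iff[OF d] inv_t by auto
  consider "i = Suc j" | "j = Suc i" | "i \<noteq> Suc j" "j \<noteq> Suc i" by blast
  then show False
  proof cases
    case 1
    then show False using up i' by simp
  next
    case 2
    then show False using up i' by simp
  next
    case 3
    then show False using neq i' by simp
  qed
qed

text \<open>An isomorphism maps covers to covers, and one that preserves descents also preserves their labels.
  Starting from the minimum, it therefore agrees with \<open>u \<sigma>\<^sub>0 \<mapsto> u \<sigma>\<close> along every chain. Comparing the
  maxima gives \<open>\<rho> = \<xi> \<sigma>\<close>, and comparing descents gives the demands of \<open>adjacency_rel\<close>.\<close>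

lemma lin_ext_if_D_equiv:
  assumes le0: "weak_L n \<sigma>\<^sub>0 (\<xi> \<circ> \<sigma>\<^sub>0)" and x: "\<xi> \<in> Sym n" and add0: "length_additive \<xi> \<sigma>\<^sub>0"
    and s: "\<sigma> \<in> Sym n" and r: "\<rho> \<in> Sym n"
    and eq: "(interval_L n \<sigma>\<^sub>0 (\<xi> \<circ> \<sigma>\<^sub>0), interval_L n \<sigma> \<rho>) \<in> D_equiv n"
  shows "\<sigma> \<in> lin_ext n (adjacency_rel n \<xi> \<sigma>\<^sub>0) \<and> \<rho> = \<xi> \<circ> \<sigma>"
proof -
  let ?top = "\<xi> \<circ> \<sigma>\<^sub>0"
  let ?J = "interval_L n \<sigma>\<^sub>0 ?top" and ?I = "interval_L n \<sigma> \<rho>"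
  have s0: "\<sigma>\<^sub>0 \<in> Sym n" and r0: "?top \<in> Sym n" using weak_L_Sym[OF le0] by auto
  obtain f where f: "bij_betw f ?J ?I"
    and iso: "\<And>\<gamma> \<delta>. \<gamma> \<in> ?J \<Longrightarrow> \<delta> \<in> ?J \<Longrightarrow> weak_L n \<gamma> \<delta> \<longleftrightarrow> weak_L n (f \<gamma>) (f \<delta>)"
    and des: "\<And>\<gamma>. \<gamma> \<in> ?J \<Longrightarrow> Des_L n \<gamma> = Des_L n (f \<gamma>)"
    using eq unfolding D_equiv_def poset_iso_L_def descent_preserving_def by blast
  have fI: "f \<gamma> \<in> ?I" if "\<gamma> \<in> ?J" for \<gamma> using f that by (auto simp: bij_betw_def)
  have surj: "\<exists>\<gamma>\<in>?J. f \<gamma> = \<delta>" if "\<delta> \<in> ?I" for \<delta>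
    using f that unfolding bij_betw_def by (metis imageE)
  have mem0: "\<sigma>\<^sub>0 \<in> ?J" "?top \<in> ?J" using le0 s0 r0 by (auto simp: interval_L_def weak_L_refl)
  have "weak_L n \<sigma> \<rho>" using fI[OF mem0(1)] weak_L_trans by (auto simp: interval_L_def)
  then have mem: "\<sigma> \<in> ?I" "\<rho> \<in> ?I" using s r by (auto simp: interval_L_def weak_L_refl)
  have f_bot: "f \<sigma>\<^sub>0 = \<sigma>"
  proof (rule weak_L_antisym)
    obtain \<gamma> where g: "\<gamma> \<in> ?J" "f \<gamma> = \<sigma>" using surj mem by blast
    then show "weak_L n (f \<sigma>\<^sub>0) \<sigma>" using iso[OF mem0(1) g(1)] by (auto simp: interval_L_def)
    show "weak_L n \<sigma> (f \<sigma>\<^sub>0)" using fI[OF mem0(1)] by (simp add: interval_L_def)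
  qed
  have f_top: "f ?top = \<rho>"
  proof (rule weak_L_antisym)
    obtain \<gamma> where g: "\<gamma> \<in> ?J" "f \<gamma> = \<rho>" using surj mem by blast
    then show "weak_L n \<rho> (f ?top)" using iso[OF g(1) mem0(2)] by (auto simp: interval_L_def)
    show "weak_L n (f ?top) \<rho>" using fI[OF mem0(2)] by (simp add: interval_L_def)
  qed
  have f_step: "f \<gamma>' = simple_transp i \<circ> f \<gamma>"
    if g: "\<gamma> \<in> ?J" "\<gamma>' \<in> ?J" and i: "i \<in> {1..<n}" and g': "\<gamma>' = simple_transp i \<circ> \<gamma>"
      and up: "inv \<gamma> i < inv \<gamma> (Suc i)" for \<gamma> \<gamma>' i
  proof -
    have gS: "\<gamma> \<in> Sym n" "\<gamma>' \<in> Sym n" using g by (auto simp: interval_L_def weak_L_def)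
    have fS: "f \<gamma> \<in> Sym n" "f \<gamma>' \<in> Sym n" using fI[OF g(1)] fI[OF g(2)] by (auto simp: interval_L_def weak_L_def)
    have step: "up_L n \<gamma> \<gamma>'" using i g' up by (auto simp: up_L_def)
    have card: "card (inversions \<gamma>') = Suc (card (inversions \<gamma>))"
      using up_L_card_inversions[OF step gS(1)] .
    have "weak_L n \<gamma> \<gamma>'" using up_L_imp_weak_L[OF step gS(1)] .
    then have "weak_L n (f \<gamma>) (f \<gamma>')" using iso[OF g] by blast
    moreover have "f \<gamma> \<noteq> f \<gamma>'"
    proof
      assume "f \<gamma> = f \<gamma>'"
      then have "\<gamma> = \<gamma>'" using f g by (auto simp: bij_betw_def dest: inj_onD)
      with card show False by simp
    qed
    ultimately obtain \<epsilon> where e: "up_L n (f \<gamma>) \<epsilon>" "(up_L n)\<^sup>*\<^sup>* \<epsilon> (f \<gamma>')"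
      unfolding weak_L_iff_up_chain by (auto elim: converse_rtranclpE)
    have eS: "\<epsilon> \<in> Sym n" using up_L_Sym[OF e(1) fS(1)] .
    have le: "weak_L n (f \<gamma>) \<epsilon>" "weak_L n \<epsilon> (f \<gamma>')"
      using up_L_imp_weak_L[OF e(1) fS(1)] e(2) eS fS(2) by (simp_all add: weak_L_iff_up_chain)
    have "weak_L n \<sigma> (f \<gamma>)" "weak_L n (f \<gamma>') \<rho>"
      using fI[OF g(1)] fI[OF g(2)] by (simp_all add: interval_L_def)
    then have "\<epsilon> \<in> ?I"
      using weak_L_trans[OF _ le(1)] weak_L_trans[OF le(2)] by (simp add: interval_L_def)
    \<comment> \<open>nothing lies strictly between \<open>\<gamma>\<close> and \<open>\<gamma>'\<close>, so the first step of the chain from \<open>f \<gamma>\<close> is its last\<close>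
    then obtain \<zeta> where z: "\<zeta> \<in> ?J" "f \<zeta> = \<epsilon>" using surj by blast
    have "weak_L n \<gamma> \<zeta>" "weak_L n \<zeta> \<gamma>'"
      using iso[OF g(1) z(1)] iso[OF z(1) g(2)] z(2) le by simp_all
    then have "\<zeta> = \<gamma> \<or> \<zeta> = \<gamma>'"
      using weak_L_eq_or_card_less[of n \<gamma> \<zeta>] weak_L_eq_or_card_less[of n \<zeta> \<gamma>'] card by auto
    moreover have "\<zeta> \<noteq> \<gamma>" using z up_L_card_inversions[OF e(1) fS(1)] by auto
    ultimately have "\<epsilon> = f \<gamma>'" using z by simp
    with e obtain j where j: "j \<in> {1..<n}" "f \<gamma>' = simple_transp j \<circ> f \<gamma>"
      "inv (f \<gamma>) j < inv (f \<gamma>) (Suc j)" by (auto simp: up_L_def)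
    have "i \<in> Des_L n \<gamma>'"
      unfolding Des_L_iff[OF gS(2)] using i up
      by (simp add: g' inv_right_mult_apply[OF simple_transp_in_Sym[OF i] gS(1)])
    moreover have "i \<notin> Des_L n \<gamma>" unfolding Des_L_iff[OF gS(1)] using up by simp
    ultimately have "i = j"
      using label_unique[OF fS(1) j(1) j(3)] des[OF g(1)] des[OF g(2)] j(2) by simp
    with j show ?thesis by simp
  qed
  have f_eq: "f (u \<circ> \<sigma>\<^sub>0) = u \<circ> \<sigma>" if "u \<circ> \<sigma>\<^sub>0 \<in> ?J" for u
  proof -
    have "(up_L n)\<^sup>*\<^sup>* \<sigma>\<^sub>0 \<gamma> \<Longrightarrow> weak_L n \<gamma> ?top \<Longrightarrow> f \<gamma> = \<gamma> \<circ> inv \<sigma>\<^sub>0 \<circ> \<sigma>" for \<gamma> :: "nat \<Rightarrow> nat"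
    proof (induction rule: rtranclp_induct)
      case base
      then show ?case using f_bot s0 by simp
    next
      case (step \<gamma> \<gamma>')
      have gS: "\<gamma> \<in> Sym n"
        using step.hyps(1) s0 by (induction rule: rtranclp_induct) (auto intro: up_L_Sym)
      have g: "weak_L n \<sigma>\<^sub>0 \<gamma>" "weak_L n \<gamma> \<gamma>'"
        using step.hyps(1) s0 gS up_L_imp_weak_L[OF step.hyps(2) gS]
        by (simp_all add: weak_L_iff_up_chain)
      have le_top: "weak_L n \<gamma>' ?top" by (rule step.prems)
      with g have mem: "\<gamma> \<in> ?J" "\<gamma>' \<in> ?J"
        using le_top weak_L_trans[OF g] weak_L_trans[OF g(2)] by (simp_all add: interval_L_def)
      obtain i where i: "i \<in> {1..<n}" "\<gamma>' = simple_transp i \<circ> \<gamma>" "inv \<gamma> i < inv \<gamma> (Suc i)"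
        using step.hyps(2) by (auto simp: up_L_def)
      have "f \<gamma> = \<gamma> \<circ> inv \<sigma>\<^sub>0 \<circ> \<sigma>" by (rule step.IH[OF weak_L_trans[OF g(2) le_top]])
      then have "f \<gamma>' = \<gamma>' \<circ> inv \<sigma>\<^sub>0 \<circ> \<sigma>" using f_step[OF mem i] by (simp add: i(2) comp_assoc)
      then show ?case .
    qed
    then have "f (u \<circ> \<sigma>\<^sub>0) = (u \<circ> \<sigma>\<^sub>0) \<circ> inv \<sigma>\<^sub>0 \<circ> \<sigma>"
      using that by (auto simp: interval_L_def weak_L_iff_up_chain)
    also have "\<dots> = u \<circ> (\<sigma>\<^sub>0 \<circ> inv \<sigma>\<^sub>0) \<circ> \<sigma>" by (simp only: comp_assoc)
    finally show ?thesis using s0 by simp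
  qed
  have "inv \<sigma> x < inv \<sigma> y" if xy: "(x, y) \<in> adjacency_rel n \<xi> \<sigma>\<^sub>0" for x y
  proof -
    from xy obtain u where rng: "x \<in> {1..n}" "y \<in> {1..n}" and lt: "inv \<sigma>\<^sub>0 x < inv \<sigma>\<^sub>0 y"
      and u: "weak_L n u \<xi>" and adj: "u y = Suc (u x) \<or> u x = Suc (u y)"
      by (auto simp: adjacency_rel_def)
    have uS: "u \<in> Sym n" using weak_L_Sym[OF u] by simp
    have mem: "u \<circ> \<sigma>\<^sub>0 \<in> ?J" using u by (auto simp: interval_L_right_mult[OF s0 x add0])
    have des_u: "Des_L n (u \<circ> \<sigma>\<^sub>0) = Des_L n (u \<circ> \<sigma>)" using des[OF mem] f_eq[OF mem] by simp
    have urng: "u x \<in> {1..n}" "u y \<in> {1..n}" using rng Sym_range_iff[OF uS] by blast+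
    have "x \<noteq> y" using lt by auto
    then have neq: "inv \<sigma> x \<noteq> inv \<sigma> y" using Sym_eq_iff[OF Sym_inv[OF s]] by simp
    note D = Des_L_iff[OF Sym_comp[OF uS s0]] Des_L_iff[OF Sym_comp[OF uS s]]
      inv_right_mult_apply[OF uS s0] inv_right_mult_apply[OF uS s]
    from adj show ?thesis
    proof
      assume a: "u y = Suc (u x)"
      have "u x \<notin> Des_L n (u \<circ> \<sigma>\<^sub>0)" unfolding D a[symmetric] using lt uS by simp
      then have "u x \<notin> Des_L n (u \<circ> \<sigma>)" using des_u by simp
      moreover have "u x \<in> {1..<n}" using urng a by simp
      ultimately show ?thesis unfolding D a[symmetric] using uS neq by auto
    next
      assume a: "u x = Suc (u y)"
      have "u y \<in> {1..<n}" using urng a by simp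
      then have "u y \<in> Des_L n (u \<circ> \<sigma>\<^sub>0)" unfolding D a[symmetric] using lt uS by simp
      then have "u y \<in> Des_L n (u \<circ> \<sigma>)" using des_u by simp
      then show ?thesis unfolding D a[symmetric] using uS by simp
    qed
  qed
  then have "\<sigma> \<in> lin_ext n (adjacency_rel n \<xi> \<sigma>\<^sub>0)" using s by (auto simp: lin_ext_def)
  moreover have "\<rho> = \<xi> \<circ> \<sigma>" using f_top f_eq[OF mem0(2)] by simp
  ultimately show ?thesis ..
qed

section \<open>The endpoints of an equivalence class\<close>

theorem theorem4p6:
  fixes n :: nat and C :: "(nat \<Rightarrow> nat) set set"
  assumes "C \<in> Int_L n // D_equiv n"
  shows "min_set n C \<in> Int_R n \<and> max_set n C \<in> Int_R n"
proof -
  obtain \<sigma>\<^sub>0 \<rho>\<^sub>0 where C: "C = D_equiv n `` {interval_L n \<sigma>\<^sub>0 \<rho>\<^sub>0}" and le0: "weak_L n \<sigma>\<^sub>0 \<rho>\<^sub>0"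
    using assms by (auto simp: Int_L_def elim!: quotientE)
  have s0: "\<sigma>\<^sub>0 \<in> Sym n" and r0: "\<rho>\<^sub>0 \<in> Sym n" using weak_L_Sym[OF le0] by auto
  define \<xi> where "\<xi> = \<rho>\<^sub>0 \<circ> inv \<sigma>\<^sub>0"
  have x: "\<xi> \<in> Sym n" unfolding \<xi>_def using r0 s0 by (intro Sym_comp Sym_inv)
  have r0_eq: "\<rho>\<^sub>0 = \<xi> \<circ> \<sigma>\<^sub>0" unfolding \<xi>_def using s0 by (simp add: comp_assoc)
  have add0: "length_additive \<xi> \<sigma>\<^sub>0" unfolding \<xi>_def by (rule weak_L_imp_length_additive[OF le0])
  let ?R = "adjacency_rel n \<xi> \<sigma>\<^sub>0"
  \<comment> \<open>the class consists of the translates of the lower interval of \<open>\<xi>\<close> by the linear extensions\<close>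
  have C_iff: "interval_L n \<sigma> \<rho> \<in> C \<longleftrightarrow> \<sigma> \<in> lin_ext n ?R \<and> \<rho> = \<xi> \<circ> \<sigma>"
    if "\<sigma> \<in> Sym n" "\<rho> \<in> Sym n" for \<sigma> \<rho>
    using D_equiv_if_lin_ext[OF s0 x add0] lin_ext_if_D_equiv[OF le0[unfolded r0_eq] x add0 that]
    unfolding C r0_eq by blast
  have lin_Sym: "\<sigma> \<in> lin_ext n R \<Longrightarrow> \<sigma> \<in> Sym n" for \<sigma> R by (simp add: lin_ext_def)
  have min: "min_set n C = lin_ext n ?R"
    unfolding min_set_def using C_iff lin_Sym Sym_comp[OF x] by blast
  \<comment> \<open>the maxima are the \<open>\<xi> \<sigma>\<close>, whose words are those of \<open>\<sigma>\<close> with every label \<open>x\<close> renamed to \<open>\<xi> x\<close>\<close>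
  have max: "max_set n C = lin_ext n (map_prod \<xi> \<xi> ` ?R)"
  proof -
    have "max_set n C = (\<lambda>\<sigma>. \<xi> \<circ> \<sigma>) ` lin_ext n ?R"
      unfolding max_set_def using C_iff lin_Sym Sym_comp[OF x] by blast
    also have "\<dots> = lin_ext n (map_prod \<xi> \<xi> ` ?R)"
    proof (intro equalityI subsetI)
      fix \<rho> assume "\<rho> \<in> (\<lambda>\<sigma>. \<xi> \<circ> \<sigma>) ` lin_ext n ?R"
      then obtain \<sigma> where s: "\<sigma> \<in> lin_ext n ?R" "\<rho> = \<xi> \<circ> \<sigma>" by blast
      then show "\<rho> \<in> lin_ext n (map_prod \<xi> \<xi> ` ?R)"
        using x Sym_comp[OF x lin_Sym[OF s(1)]]
        by (auto simp: lin_ext_def inv_right_mult_apply[OF x])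
    next
      fix \<rho> assume r: "\<rho> \<in> lin_ext n (map_prod \<xi> \<xi> ` ?R)"
      define \<sigma> where "\<sigma> = inv \<xi> \<circ> \<rho>"
      have s: "\<sigma> \<in> Sym n" unfolding \<sigma>_def using x lin_Sym[OF r] by (intro Sym_comp Sym_inv)
      have "\<rho> = \<xi> \<circ> inv \<xi> \<circ> \<rho>" using x by simp
      then have rs: "\<rho> = \<xi> \<circ> \<sigma>" by (simp only: \<sigma>_def comp_assoc)
      have "\<sigma> \<in> lin_ext n ?R"
        unfolding lin_ext_def
      proof (intro CollectI conjI s allI impI)
        fix a b assume "(a, b) \<in> ?R"
        then have "inv \<rho> (\<xi> a) < inv \<rho> (\<xi> b)"
          using r unfolding lin_ext_def by (blast intro: map_prod_imageI)
        then show "inv \<sigma> a < inv \<sigma> b" using x s by (simp add: rs inv_right_mult_apply)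
      qed
      with rs show "\<rho> \<in> (\<lambda>\<sigma>. \<xi> \<circ> \<sigma>) ` lin_ext n ?R" by blast
    qed
    finally show ?thesis .
  qed
  have "interval_L n \<sigma>\<^sub>0 \<rho>\<^sub>0 \<in> C"
    unfolding C using s0 r0 le0 by (intro equiv_class_self[OF equiv_D_equiv]) (auto simp: Int_L_def)
  then have "\<sigma>\<^sub>0 \<in> min_set n C" "\<rho>\<^sub>0 \<in> max_set n C"
    unfolding min_set_def max_set_def using s0 r0 by blast+
  then have ne: "lin_ext n ?R \<noteq> {}" "lin_ext n (map_prod \<xi> \<xi> ` ?R) \<noteq> {}"
    unfolding min max by blast+
  have "regular_rel (map_prod id id ` ?R)" "regular_rel (map_prod \<xi> \<xi> ` ?R)"
    using regular_adjacency_rel[OF x add0] weak_L_id[OF x] weak_L_refl[OF x] by blast+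
  then show ?thesis
    unfolding min max using lin_ext_in_Int_R ne by (simp add: prod.map_id)
qed

end
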